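(* Let $\mathrm{Stat},\mathrm{Stat}_\gamma,\mathrm{Stat}_\beta$ be statistics on permutations with $\mathrm{Stat}=\mathrm{Stat}_\beta+\mathrm{Stat}_\gamma$. Assume $\mathrm{Stat}_\gamma$ is one of: eareccdfall, ereccdrise, cdrise, cdfall, nrfix, psnest. Assume $\mathrm{Stat}_\beta$ is one of: nrcpeak, nrcval, nminval, $\mathrm{eareccpeak}+\mathrm{ereccval}$, $\mathrm{eareccpeak}+\mathrm{minval}$, $\mathrm{nrcpeak}+\mathrm{nrcval}+\mathrm{nrcdrise}+\mathrm{nrcdfall}$, lcrosscpeak, lcross, lnestcpeak, lnest, ucrosscval, ucross, unestcval, unest, $\mathrm{ucross}+\mathrm{lcross}$, $\mathrm{lnest}+\mathrm{unest}$. Then $\mathrm{Stat}$ exhibits the cyclic sieving phenomenon with respect to involutions that have $1$ fixed point when $n=0$ and $2^{n-1}$ fixed points when $n\ge1$.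
   Context: $\mathfrak{S}_n$ is the set of permutations of $[n]$. For $\sigma\in\mathfrak{S}_n$, $i\in[n]$ is a cycle peak if $\sigma^{-1}(i)<i>\sigma(i)$, cycle valley if $\sigma^{-1}(i)>i<\sigma(i)$, cycle double rise if $\sigma^{-1}(i)<i<\sigma(i)$, cycle double fall if $\sigma^{-1}(i)>i>\sigma(i)$, fixed point if $\sigma(i)=i$. $i$ is a record if $\sigma(j)<\sigma(i)$ for all $j<i$; an antirecord if $\sigma(j)>\sigma(i)$ for all $j>i$; exclusive record = record not antirecord; exclusive antirecord = antirecord not record; neither-record-antirecord = neither. Statistics: cdrise/cdfall = number of cycle double rises/falls; eareccpeak/eareccdfall = number of cycle peaks/double falls that are exclusive antirecords; ereccval/ereccdrise = number of cycle valleys/double rises that are exclusive records; nrcpeak, nrcval, nrcdrise, nrcdfall, nrfix = number of cycle peaks, cycle valleys, cycle double rises, cycle double falls, fixed points that are neither-record-antirecords; minval = number of cycle valleys that are the smallest element of their cycle; nminval = number of the other cycle valleys; $\mathrm{psnest}(\sigma)=\sum_{i\ \mathrm{fixed}}\#\{j<i:\sigma(j)>i\}$. Crossings/nestings: $\mathrm{ucross}(i,\sigma)=\#\{j:j<i<\sigma(j)<\sigma(i)\}$, $\mathrm{unest}(i,\sigma)=\#\{j:j<i<\sigma(i)<\sigma(j)\}$, $\mathrm{lcross}(i,\sigma)=\#\{j:j>i>\sigma(j)>\sigma(i)\}$, $\mathrm{lnest}(i,\sigma)=\#\{j:j>i>\sigma(i)>\sigma(j)\}$; ucross, unest, lcross,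 lnest are the sums over all $i\in[n]$; ucrosscval, unestcval are the sums of $\mathrm{ucross}(i,\sigma)$, $\mathrm{unest}(i,\sigma)$ over cycle valleys $i$; lcrosscpeak, lnestcpeak are the sums of $\mathrm{lcross}(i,\sigma)$, $\mathrm{lnest}(i,\sigma)$ over cycle peaks $i$. Cyclic sieving for involutions: for an involution $\phi$ on a finite set $X$ and polynomial $f$, $(X,\{\mathrm{id},\phi\},f)$ exhibits the CSP iff $f(1)=|X|$ and $f(-1)=\#\{x:\phi(x)=x\}$. A statistic $\mathrm{Stat}$ on permutations exhibits the CSP with respect to involutions having $a_n$ fixed points if for every $n\ge0$ and every involution $\phi$ of $\mathfrak{S}_n$ with exactly $a_n$ fixed points, $(\mathfrak{S}_n,\{\mathrm{id},\phi\},\sum_{\sigma\in\mathfrak{S}_n}q^{\mathrm{Stat}(\sigma)})$ exhibits the CSP. *)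

theory Defs
  imports
    "HOL-Combinatorics.Permutations"
    "HOL-Combinatorics.Orbits"
    "HOL-Computational_Algebra.Polynomial"
begin

definition perms :: "nat \<Rightarrow> (nat \<Rightarrow> nat) set" where
  "perms n = {\<sigma>. \<sigma> permutes {1..n}}"

text \<open>A statistic takes the size \<open>n\<close> as well as \<open>\<sigma>\<close>, since a function
  permuting \<open>{1..n}\<close> does not determine \<open>n\<close>. Only its values at
  \<open>\<sigma> \<in> perms n\<close> matter.\<close>

type_synonym perm_stat = "nat \<Rightarrow> (nat \<Rightarrow> nat) \<Rightarrow> nat"

definition cpeaks :: "nat \<Rightarrow> (nat \<Rightarrow> nat) \<Rightarrow> nat set" where
  "cpeaks n \<sigma> = {i \<in> {1..n}. inv \<sigma> i < i \<and> i > \<sigma> i}"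

definition cvals :: "nat \<Rightarrow> (nat \<Rightarrow> nat) \<Rightarrow> nat set" where
  "cvals n \<sigma> = {i \<in> {1..n}. inv \<sigma> i > i \<and> i < \<sigma> i}"

definition cdrises :: "nat \<Rightarrow> (nat \<Rightarrow> nat) \<Rightarrow> nat set" where
  "cdrises n \<sigma> = {i \<in> {1..n}. inv \<sigma> i < i \<and> i < \<sigma> i}"

definition cdfalls :: "nat \<Rightarrow> (nat \<Rightarrow> nat) \<Rightarrow> nat set" where
  "cdfalls n \<sigma> = {i \<in> {1..n}. inv \<sigma> i > i \<and> i > \<sigma> i}"

definition fixes_of :: "nat \<Rightarrow> (nat \<Rightarrow> nat) \<Rightarrow> nat set" where
  "fixes_of n \<sigma> = {i \<in> {1..n}. \<sigma> i = i}"

definition recs :: "nat \<Rightarrow> (nat \<Rightarrow> nat) \<Rightarrow> nat set" where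
  "recs n \<sigma> = {i \<in> {1..n}. \<forall>j\<in>{1..n}. j < i \<longrightarrow> \<sigma> j < \<sigma> i}"

definition arecs :: "nat \<Rightarrow> (nat \<Rightarrow> nat) \<Rightarrow> nat set" where
  "arecs n \<sigma> = {i \<in> {1..n}. \<forall>j\<in>{1..n}. j > i \<longrightarrow> \<sigma> j > \<sigma> i}"

definition erecs :: "nat \<Rightarrow> (nat \<Rightarrow> nat) \<Rightarrow> nat set" where
  "erecs n \<sigma> = recs n \<sigma> - arecs n \<sigma>"

definition earecs :: "nat \<Rightarrow> (nat \<Rightarrow> nat) \<Rightarrow> nat set" where
  "earecs n \<sigma> = arecs n \<sigma> - recs n \<sigma>"

definition nrars :: "nat \<Rightarrow> (nat \<Rightarrow> nat) \<Rightarrow> nat set" where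
  "nrars n \<sigma> = {1..n} - (recs n \<sigma> \<union> arecs n \<sigma>)"

definition cdrise :: perm_stat where
  "cdrise n \<sigma> = card (cdrises n \<sigma>)"

definition cdfall :: perm_stat where
  "cdfall n \<sigma> = card (cdfalls n \<sigma>)"

definition eareccpeak :: perm_stat where
  "eareccpeak n \<sigma> = card (cpeaks n \<sigma> \<inter> earecs n \<sigma>)"

definition eareccdfall :: perm_stat where
  "eareccdfall n \<sigma> = card (cdfalls n \<sigma> \<inter> earecs n \<sigma>)"

definition ereccval :: perm_stat where
  "ereccval n \<sigma> = card (cvals n \<sigma> \<inter> erecs n \<sigma>)"

definition ereccdrise :: perm_stat where
  "ereccdrise n \<sigma> = card (cdrises n \<sigma> \<inter> erecs n \<sigma>)"

definition nrcpeak :: perm_stat where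
  "nrcpeak n \<sigma> = card (cpeaks n \<sigma> \<inter> nrars n \<sigma>)"

definition nrcval :: perm_stat where
  "nrcval n \<sigma> = card (cvals n \<sigma> \<inter> nrars n \<sigma>)"

definition nrcdrise :: perm_stat where
  "nrcdrise n \<sigma> = card (cdrises n \<sigma> \<inter> nrars n \<sigma>)"

definition nrcdfall :: perm_stat where
  "nrcdfall n \<sigma> = card (cdfalls n \<sigma> \<inter> nrars n \<sigma>)"

definition nrfix :: perm_stat where
  "nrfix n \<sigma> = card (fixes_of n \<sigma> \<inter> nrars n \<sigma>)"

text \<open>For a permutation \<open>\<sigma>\<close> of a finite set, \<open>orbit \<sigma> i\<close> is the cycle of
  \<open>\<sigma>\<close> containing \<open>i\<close>.\<close>

definition minval :: perm_stat where
  "minval n \<sigma> = card {i \<in> cvals n \<sigma>. \<forall>j\<in>orbit \<sigma> i. i \<le> j}"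

definition nminval :: perm_stat where
  "nminval n \<sigma> = card {i \<in> cvals n \<sigma>. \<not> (\<forall>j\<in>orbit \<sigma> i. i \<le> j)}"

definition psnest :: perm_stat where
  "psnest n \<sigma> = (\<Sum>i\<in>fixes_of n \<sigma>. card {j \<in> {1..n}. j < i \<and> \<sigma> j > i})"

definition ucross_at :: "nat \<Rightarrow> nat \<Rightarrow> (nat \<Rightarrow> nat) \<Rightarrow> nat" where
  "ucross_at n i \<sigma> = card {j \<in> {1..n}. j < i \<and> i < \<sigma> j \<and> \<sigma> j < \<sigma> i}"

definition unest_at :: "nat \<Rightarrow> nat \<Rightarrow> (nat \<Rightarrow> nat) \<Rightarrow> nat" where
  "unest_at n i \<sigma> = card {j \<in> {1..n}. j < i \<and> i < \<sigma> i \<and> \<sigma> i < \<sigma> j}"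

definition lcross_at :: "nat \<Rightarrow> nat \<Rightarrow> (nat \<Rightarrow> nat) \<Rightarrow> nat" where
  "lcross_at n i \<sigma> = card {j \<in> {1..n}. j > i \<and> i > \<sigma> j \<and> \<sigma> j > \<sigma> i}"

definition lnest_at :: "nat \<Rightarrow> nat \<Rightarrow> (nat \<Rightarrow> nat) \<Rightarrow> nat" where
  "lnest_at n i \<sigma> = card {j \<in> {1..n}. j > i \<and> i > \<sigma> i \<and> \<sigma> i > \<sigma> j}"

definition ucross :: perm_stat where
  "ucross n \<sigma> = (\<Sum>i\<in>{1..n}. ucross_at n i \<sigma>)"

definition unest :: perm_stat where
  "unest n \<sigma> = (\<Sum>i\<in>{1..n}. unest_at n i \<sigma>)"

definition lcross :: perm_stat where
  "lcross n \<sigma> = (\<Sum>i\<in>{1..n}. lcross_at n i \<sigma>)"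

definition lnest :: perm_stat where
  "lnest n \<sigma> = (\<Sum>i\<in>{1..n}. lnest_at n i \<sigma>)"

definition ucrosscval :: perm_stat where
  "ucrosscval n \<sigma> = (\<Sum>i\<in>cvals n \<sigma>. ucross_at n i \<sigma>)"

definition unestcval :: perm_stat where
  "unestcval n \<sigma> = (\<Sum>i\<in>cvals n \<sigma>. unest_at n i \<sigma>)"

definition lcrosscpeak :: perm_stat where
  "lcrosscpeak n \<sigma> = (\<Sum>i\<in>cpeaks n \<sigma>. lcross_at n i \<sigma>)"

definition lnestcpeak :: perm_stat where
  "lnestcpeak n \<sigma> = (\<Sum>i\<in>cpeaks n \<sigma>. lnest_at n i \<sigma>)"

definition involution_on :: "'a set \<Rightarrow> ('a \<Rightarrow> 'a) \<Rightarrow> bool" where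
  "involution_on X \<phi> \<longleftrightarrow> (\<forall>x\<in>X. \<phi> x \<in> X \<and> \<phi> (\<phi> x) = x)"

definition involution_csp :: "'a set \<Rightarrow> ('a \<Rightarrow> 'a) \<Rightarrow> int poly \<Rightarrow> bool" where
  "involution_csp X \<phi> f \<longleftrightarrow>
     poly f 1 = int (card X) \<and> poly f (- 1) = int (card {x \<in> X. \<phi> x = x})"

definition stat_poly :: "perm_stat \<Rightarrow> nat \<Rightarrow> int poly" where
  "stat_poly Stat n = (\<Sum>\<sigma>\<in>perms n. monom 1 (Stat n \<sigma>))"

definition exhibits_csp :: "perm_stat \<Rightarrow> (nat \<Rightarrow> nat) \<Rightarrow> bool" where
  "exhibits_csp Stat a \<longleftrightarrow>
     (\<forall>n \<phi>. involution_on (perms n) \<phi> \<and> card {\<sigma> \<in> perms n. \<phi> \<sigma> = \<sigma>} = a n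
        \<longrightarrow> involution_csp (perms n) \<phi> (stat_poly Stat n))"

end

theory Submission
  imports Defs
begin

text \<open>
  The claim is that the signed count of permutations, each weighted by the parity of the
  statistic, equals \<open>2 ^ (n - 1)\<close>.

  Suppose that \<open>i\<close> is a cycle valley covered by exactly one arc, i.e. there is exactly one
  \<open>j < i\<close> with \<open>\<sigma> j > i\<close>. Exchanging the values of \<open>\<sigma>\<close> at \<open>i\<close> and \<open>j\<close> preserves all
  cycle types, all antirecords, all records other than \<open>i\<close>, and all crossings and nestings except
  that the pair \<open>(j, i)\<close> changes from crossing to nesting or back; it also changes the number of
  cycles by one. Hence it flips the parity of every \<open>\<beta>\<close>-statistic about valleys and keeps every
  \<open>\<gamma>\<close>-statistic. The \<open>\<beta>\<close>-statistics about peaks reduce to these by conjugation with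
  \<open>x \<mapsto> n + 1 - x\<close>.

  The permutations without such a valley are those with at most one arc over every gap between
  \<open>k\<close> and \<open>k + 1\<close>. There every \<open>\<beta>\<close>-statistic is even, and every \<open>\<gamma>\<close>-statistic counts the
  cycle double rises, the cycle double falls, or the nested fixed points. With \<open>t\<close> the
  transposition of \<open>n\<close> and \<open>n + 1\<close>, such permutations of size \<open>n + 1\<close> are the \<open>\<tau>\<close>, \<open>\<tau> t\<close>,
  \<open>t \<tau>\<close> and \<open>t \<tau> t\<close> with \<open>\<tau>\<close> of size \<open>n\<close>. If \<open>\<tau>\<close> moves \<open>n\<close>, the last three turn \<open>n\<close> into a
  double rise, a double fall and a nested fixed point, so that one of them changes sign; if \<open>\<tau>\<close>
  fixes \<open>n\<close>, only \<open>\<tau>\<close> and \<open>\<tau> t\<close> are distinct, and both keep the sign. In either case the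
  signed count doubles.
\<close>

section \<open>Sign-reversing involutions and elementary facts on permutations\<close>

lemma sum_eq_0_if_sign_reversing:
  fixes f :: "'a \<Rightarrow> int"
  assumes "\<And>x. x \<in> A \<Longrightarrow> \<phi> x \<in> A" "\<And>x. x \<in> A \<Longrightarrow> \<phi> (\<phi> x) = x"
    and "\<And>x. x \<in> A \<Longrightarrow> f (\<phi> x) = - f x"
  shows "sum f A = 0"
proof -
  have "sum f A = (\<Sum>x\<in>A. f (\<phi> x))"
    by (rule sum.reindex_bij_witness[of _ \<phi> \<phi>]) (use assms in auto)
  also have "\<dots> = - sum f A"
    using assms(3) by (simp add: sum_negf)
  finally show ?thesis by simp
qed

text \<open>The set \<open>{..k}\<close> and its preimage under \<sigma> are equinumerous, so
  removing their intersection leaves equally many points on both sides. Thus every gap is crossed by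
  as many rising arcs as falling ones.\<close>

lemma permutes_card_crossing:
  fixes \<sigma> :: "nat \<Rightarrow> nat"
  assumes "\<sigma> permutes {1..n}"
  shows "card {l. l \<le> k \<and> k < \<sigma> l} = card {l. k < l \<and> \<sigma> l \<le> k}"
proof -
  let ?A = "{..k}" and ?B = "\<sigma> -` {..k}"
  have inj: "inj \<sigma>" and surj: "surj \<sigma>"
    using assms by (auto simp: permutes_inj permutes_surj)
  have fin: "finite ?B" using inj by (simp add: finite_vimageI)
  have "card ?B = card ?A"
    using inj surj by (simp add: card_vimage_inj)
  moreover have "card ?A = card (?A \<inter> ?B) + card (?A - ?B)"
    by (rule card_Int_Diff) simp
  moreover have "card ?B = card (?A \<inter> ?B) + card (?B - ?A)"
    using card_Int_Diff[OF fin, of ?A] by (simp add: Int_commute)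
  moreover have "?A - ?B = {l. l \<le> k \<and> k < \<sigma> l}" "?B - ?A = {l. k < l \<and> \<sigma> l \<le> k}"
    by auto
  ultimately show ?thesis by simp
qed

text \<open>Points outside the range are fixed, so both equivalences hold for every \<open>k\<close>
  and can serve as rewrite rules without a membership premise.\<close>

lemma permutes_bounds:
  fixes \<sigma> :: "nat \<Rightarrow> nat"
  assumes "\<sigma> permutes {1..n}"
  shows "Suc 0 \<le> \<sigma> k \<longleftrightarrow> Suc 0 \<le> k" "\<sigma> k \<le> n \<longleftrightarrow> k \<le> n"
proof -
  have in_iff: "\<sigma> k \<in> {1..n} \<longleftrightarrow> k \<in> {1..n}" by (rule permutes_in_image[OF assms])
  have "\<sigma> k = k" if "k \<notin> {1..n}"
    using assms that by (rule permutes_not_in)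
  with in_iff show "Suc 0 \<le> \<sigma> k \<longleftrightarrow> Suc 0 \<le> k" "\<sigma> k \<le> n \<longleftrightarrow> k \<le> n"
    by (cases "k \<in> {1..n}"; simp)+
qed

text \<open>At a record, \<sigma> maps \<open>{1..k}\<close> injectively into
  \<open>{1..\<sigma> k}\<close>; compare the sizes.\<close>

lemma recs_imp_le:
  assumes "\<sigma> permutes {1..n}" "k \<in> recs n \<sigma>"
  shows "k \<le> \<sigma> k"
proof -
  have "\<sigma> ` {1..k} \<subseteq> {1..\<sigma> k}"
  proof
    fix x assume "x \<in> \<sigma> ` {1..k}"
    then obtain l where l: "l \<in> {1..k}" "x = \<sigma> l" by auto
    with assms have "l \<in> {1..n}" "\<sigma> l \<in> {1..n}"
      by (auto simp: recs_def permutes_bounds[OF assms(1)])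
    with l assms show "x \<in> {1..\<sigma> k}"
      by (cases "l = k") (auto simp: recs_def order.strict_iff_order)
  qed
  then have "card (\<sigma> ` {1..k}) \<le> card {1..\<sigma> k}"
    by (intro card_mono) auto
  then show ?thesis
    using assms by (simp add: card_image permutes_inj_on)
qed

text \<open>Dually, at an antirecord the final segment \<open>{k..n}\<close> is mapped injectively
  into \<open>{\<sigma> k..n}\<close>.\<close>

lemma arecs_imp_ge:
  assumes "\<sigma> permutes {1..n}" "k \<in> arecs n \<sigma>"
  shows "\<sigma> k \<le> k"
proof -
  have k: "k \<in> {1..n}" "\<sigma> k \<in> {1..n}"
    using assms by (auto simp: arecs_def permutes_bounds[OF assms(1)])
  have "\<sigma> ` {k..n} \<subseteq> {\<sigma> k..n}"
  proof
    fix x assume "x \<in> \<sigma> ` {k..n}"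
    then obtain l where l: "l \<in> {k..n}" "x = \<sigma> l" by auto
    with k assms(1) have "l \<in> {1..n}" "\<sigma> l \<in> {1..n}"
      by (auto simp: permutes_bounds[OF assms(1)])
    with l assms show "x \<in> {\<sigma> k..n}"
      by (cases "l = k") (auto simp: arecs_def order.strict_iff_order)
  qed
  then have "card (\<sigma> ` {k..n}) \<le> card {\<sigma> k..n}"
    by (intro card_mono) auto
  then have "Suc n - k \<le> Suc n - \<sigma> k"
    using assms by (simp add: card_image permutes_inj_on)
  then show ?thesis using k by (simp add: le_diff_iff')
qed

text \<open>The map \<sigma> is a bijection from the starts of rising arcs (valleys and double
  rises) to their ends (peaks and double rises); the double rises cancel.\<close>

lemma card_cpeaks_eq_card_cvals:
  assumes "\<sigma> permutes {1..n}"
  shows "card (cpeaks n \<sigma>) = card (cvals n \<sigma>)"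
proof -
  have "card {k \<in> {1..n}. k < \<sigma> k} = card {k \<in> {1..n}. inv \<sigma> k < k}"
    by (rule bij_betw_same_card[of \<sigma>], rule bij_betwI[where g = "inv \<sigma>"])
      (use assms permutes_in_image[OF assms] permutes_in_image[OF permutes_inv[OF assms]]
        permutes_inverses[OF assms] in auto)
  moreover have "{k \<in> {1..n}. k < \<sigma> k} = cvals n \<sigma> \<union> cdrises n \<sigma>"
  proof -
    have "inv \<sigma> k \<noteq> k" if "k < \<sigma> k" for k
      using that permutes_inverses(1)[OF assms, of k] by (metis less_irrefl)
    then show ?thesis by (auto simp: cvals_def cdrises_def) (metis linorder_neqE_nat)
  qed
  moreover have "{k \<in> {1..n}. inv \<sigma> k < k} = cpeaks n \<sigma> \<union> cdrises n \<sigma>"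
  proof -
    have "\<sigma> k \<noteq> k" if "inv \<sigma> k < k" for k
      using that permutes_inverses(2)[OF assms, of k] by (metis less_irrefl)
    then show ?thesis by (auto simp: cpeaks_def cdrises_def) (metis linorder_neqE_nat)
  qed
  moreover have "card (cvals n \<sigma> \<union> cdrises n \<sigma>) = card (cvals n \<sigma>) + card (cdrises n \<sigma>)"
    by (intro card_Un_disjoint) (auto simp: cvals_def cdrises_def)
  moreover have "card (cpeaks n \<sigma> \<union> cdrises n \<sigma>) = card (cpeaks n \<sigma>) + card (cdrises n \<sigma>)"
    by (intro card_Un_disjoint) (auto simp: cpeaks_def cdrises_def)
  ultimately show ?thesis by simp
qed

subsection \<open>Cycle minima and the sign\<close>

definition cycle_minima :: "nat \<Rightarrow> (nat \<Rightarrow> nat) \<Rightarrow> nat set" where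
  "cycle_minima n \<sigma> = {k \<in> {1..n}. \<forall>j\<in>orbit \<sigma> k. k \<le> j}"

text \<open>Each cycle, fixed points included, has one minimum, so this is the formula for the sign
  by the number \<open>c\<close> of cycles; \<open>n + c\<close> has the parity of the usual
  \<open>n - c\<close>. The induction cuts the largest point out of its cycle.\<close>

lemma sign_eq_cycle_minima:
  assumes "\<sigma> permutes {1..n}"
  shows "sign \<sigma> = (- 1) ^ (n + card (cycle_minima n \<sigma>))"
  using assms
proof (induction n arbitrary: \<sigma>)
  case 0
  then show ?case by (simp add: cycle_minima_def)
next
  case (Suc n)
  let ?N = "Suc n"
  \<comment> \<open>Applied after \<sigma>, this transposition fixes \<open>?N\<close> and sends the
    predecessor of \<open>?N\<close> straight to its successor. If \<open>?N\<close> is already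
    fixed, it is the identity.\<close>
  let ?t = "transpose ?N (\<sigma> ?N)"
  let ?\<tau> = "?t \<circ> \<sigma>"
  have N: "\<sigma> ?N \<in> {1..?N}"
    using Suc.prems by (simp only: permutes_in_image) simp
  have t: "?t permutes {1..?N}"
    using N by (intro permutes_swap_id) auto
  have perm: "?\<tau> permutes {1..?N}"
    using Suc.prems t by (rule permutes_compose)
  have \<tau>: "?\<tau> permutes {1..n}"
    using perm by (rule permutes_superset) (auto simp: le_Suc_eq)
  have \<tau>_apply: "?\<tau> x = (if \<sigma> x = ?N then \<sigma> ?N else \<sigma> x)" if "x \<noteq> ?N" for x
    using that permutes_inj[OF Suc.prems] by (auto simp: transpose_def dest: injD)
  have \<tau>_N: "?\<tau> ?N = ?N" by simp
  have sub1: "j \<in> orbit \<sigma> k" if "j \<in> orbit ?\<tau> k" "k \<noteq> ?N" for j k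
    using that(1)
  proof induction
    case base
    then show ?case
      using that(2) \<tau>_apply[of k] by (metis orbit.base orbit.step)
  next
    case (step j)
    then show ?case
      using \<tau>_apply[of j] \<tau>_N by (metis orbit.step)
  qed
  \<comment> \<open>A \<sigma>-orbit may pass through \<open>?N\<close>, which the shortened cycle
    skips. At that point the induction carries the next element instead.\<close>
  have sub2: "if j = ?N then \<sigma> ?N \<in> orbit ?\<tau> k else j \<in> orbit ?\<tau> k"
    if "j \<in> orbit \<sigma> k" "k \<noteq> ?N" for j k
    using that(1)
  proof induction
    case base
    then show ?case
      using that(2) \<tau>_apply[of k] by (metis orbit.base)
  next
    case (step j)
    then show ?case
      using \<tau>_apply[of j] \<tau>_N by (metis orbit.step)
  qed
  have min_iff: "(\<forall>j\<in>orbit \<sigma> k. k \<le> j) \<longleftrightarrow> (\<forall>j\<in>orbit ?\<tau> k. k \<le> j)" if "k \<le> n" for k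
  proof
    assume "\<forall>j\<in>orbit \<sigma> k. k \<le> j"
    then show "\<forall>j\<in>orbit ?\<tau> k. k \<le> j" using sub1[of _ k] that by auto
  next
    assume *: "\<forall>j\<in>orbit ?\<tau> k. k \<le> j"
    show "\<forall>j\<in>orbit \<sigma> k. k \<le> j"
    proof
      fix j assume "j \<in> orbit \<sigma> k"
      then show "k \<le> j"
        using sub2[of j k] that * by (cases "j = ?N") auto
    qed
  qed
  \<comment> \<open>The largest point can be minimal only in a cycle of length one; this is where a
    fixed \<open>?N\<close> contributes an extra minimum.\<close>
  have min_N: "(\<forall>j\<in>orbit \<sigma> ?N. ?N \<le> j) \<longleftrightarrow> \<sigma> ?N = ?N"
  proof
    assume "\<forall>j\<in>orbit \<sigma> ?N. ?N \<le> j"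
    then have "?N \<le> \<sigma> ?N" by (simp add: orbit.base)
    with N show "\<sigma> ?N = ?N" by simp
  next
    assume "\<sigma> ?N = ?N"
    then have "orbit \<sigma> ?N = {?N}" by (simp add: orbit_eq_singleton_iff)
    then show "\<forall>j\<in>orbit \<sigma> ?N. ?N \<le> j" by simp
  qed
  have "cycle_minima ?N \<sigma> = cycle_minima n ?\<tau> \<union> (if \<sigma> ?N = ?N then {?N} else {})"
    using min_iff min_N by (auto simp: cycle_minima_def le_Suc_eq)
  moreover have "?N \<notin> cycle_minima n ?\<tau>" "finite (cycle_minima n ?\<tau>)"
    by (auto simp: cycle_minima_def)
  ultimately have card: "card (cycle_minima ?N \<sigma>) =
      card (cycle_minima n ?\<tau>) + (if \<sigma> ?N = ?N then 1 else 0)"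
    by auto
  have "\<sigma> = ?t \<circ> ?\<tau>"
    by (simp add: fun_eq_iff)
  then have "sign \<sigma> = sign ?t * sign ?\<tau>"
    using sign_compose[of ?t ?\<tau>] t perm permutes_imp_permutation by (metis finite_atLeastAtMost)
  also have "\<dots> = (if \<sigma> ?N = ?N then 1 else - 1) * (- 1) ^ (n + card (cycle_minima n ?\<tau>))"
    unfolding Suc.IH[OF \<tau>] sign_swap_id by auto
  finally show ?case using card by simp
qed

text \<open>A cycle minimum that is not fixed has both neighbours in its cycle above it, so it is a
  valley. Together with \<open>sign_eq_cycle_minima\<close> this relates the parity of
  \<open>minval\<close> to the sign.\<close>

lemma card_cycle_minima:
  assumes "\<sigma> permutes {1..n}"
  shows "card (cycle_minima n \<sigma>) = card (fixes_of n \<sigma>) + minval n \<sigma>"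
proof -
  let ?M = "{i \<in> cvals n \<sigma>. \<forall>j\<in>orbit \<sigma> i. i \<le> j}"
  have "permutation \<sigma>"
    using assms permutes_imp_permutation by (metis finite_atLeastAtMost)
  then have inv_orbit: "inv \<sigma> k \<in> orbit \<sigma> k" for k
    using orbit_inv_eq[of \<sigma>] by (metis orbit.base)
  have "cycle_minima n \<sigma> = fixes_of n \<sigma> \<union> ?M"
  proof (intro set_eqI iffI)
    fix k assume k: "k \<in> cycle_minima n \<sigma>"
    then have "k \<le> \<sigma> k" "k \<le> inv \<sigma> k"
      using inv_orbit[of k] orbit.base[of \<sigma> k] by (auto simp: cycle_minima_def)
    moreover have "inv \<sigma> k = k \<longleftrightarrow> \<sigma> k = k"
      using permutes_inverses[OF assms] by metis
    ultimately show "k \<in> fixes_of n \<sigma> \<union> ?M"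
      using k by (auto simp: cycle_minima_def fixes_of_def cvals_def)
  next
    fix k assume "k \<in> fixes_of n \<sigma> \<union> ?M"
    then show "k \<in> cycle_minima n \<sigma>"
      using orbit_eq_singleton_iff[of \<sigma> k]
      by (auto simp: cycle_minima_def fixes_of_def cvals_def)
  qed
  moreover have "card (fixes_of n \<sigma> \<union> ?M) = card (fixes_of n \<sigma>) + card ?M"
    by (intro card_Un_disjoint) (auto simp: fixes_of_def cvals_def)
  ultimately show ?thesis by (simp add: minval_def)
qed

subsection \<open>The sign-reversing exchange\<close>

definition single_cover_valley :: "(nat \<Rightarrow> nat) \<Rightarrow> nat \<Rightarrow> bool" where
  "single_cover_valley \<sigma> i \<longleftrightarrow> i < \<sigma> i \<and> i < inv \<sigma> i \<and> card {l. l < i \<and> i < \<sigma> l} = 1"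

text \<open>The equation \<open>cover\<close> says that a single arc passes over the valley
  \<open>i\<close> and at the same time names the start \<open>j\<close> of this arc.\<close>

locale valley_swap =
  fixes n :: nat and \<sigma> :: "nat \<Rightarrow> nat" and i j :: nat
  assumes perm: "\<sigma> permutes {1..n}"
    and valley: "i < \<sigma> i" "i < inv \<sigma> i"
    and cover: "{l. l < i \<and> i < \<sigma> l} = {j}"
begin

definition swapped :: "nat \<Rightarrow> nat" where
  "swapped = \<sigma> \<circ> transpose i j"

lemma ji: "j < i" "i < \<sigma> j"
  using cover by auto

text \<open>Such a value does not exceed \<open>i\<close> because \<open>j\<close> starts the only
  arc over \<open>i\<close>, and it is not \<open>i\<close> because the preimage of the valley
  \<open>i\<close> lies above \<open>i\<close>.\<close>

lemma below: "\<sigma> l < i" if "l < i" "l \<noteq> j"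
proof -
  have "\<sigma> l \<noteq> i"
    using that valley permutes_inverses(2)[OF perm, of l] by auto
  moreover have "\<not> i < \<sigma> l" using cover that by auto
  ultimately show ?thesis by simp
qed

lemma i_range: "i \<in> {1..n}" and j_range: "j \<in> {1..n}"
proof -
  show "i \<in> {1..n}" using valley(1) permutes_not_in[OF perm, of i] by (metis less_irrefl)
  show "j \<in> {1..n}" using ji permutes_not_in[OF perm, of j] by (metis less_asym)
qed

lemma swapped_permutes: "swapped permutes {1..n}"
  unfolding swapped_def using i_range j_range perm
  by (intro permutes_compose permutes_swap_id)

lemma swapped_i [simp]: "swapped i = \<sigma> j"
  and swapped_j [simp]: "swapped j = \<sigma> i"
  by (simp_all add: swapped_def)

lemma swapped_cases: "swapped l = (if l = i then \<sigma> j else if l = j then \<sigma> i else \<sigma> l)"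
  by (simp add: swapped_def transpose_def)

lemma \<sigma>_neq: "\<sigma> i \<noteq> \<sigma> j"
  using permutes_inj[OF perm] ji by (auto dest: injD)

text \<open>Only \<open>i\<close> and \<open>j\<close> get new values, and both old and new values
  exceed \<open>i\<close>, hence exceed both positions.\<close>

lemma swapped_less_iff: "l < swapped l \<longleftrightarrow> l < \<sigma> l" "swapped l < l \<longleftrightarrow> \<sigma> l < l"
  "swapped l = l \<longleftrightarrow> \<sigma> l = l"
  using ji valley by (auto simp: swapped_cases)

lemma inv_swapped: "inv swapped l = transpose i j (inv \<sigma> l)"
  unfolding swapped_def using permutes_bij[OF perm]
  by (simp add: o_inv_distrib)

text \<open>A point whose preimage is \<open>i\<close> or \<open>j\<close> lies above both of them,
  so it does not matter which of the two it is.\<close>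

lemma inv_swapped_less_iff: "l < inv swapped l \<longleftrightarrow> l < inv \<sigma> l"
  "inv swapped l < l \<longleftrightarrow> inv \<sigma> l < l"
proof -
  have "i < l \<and> j < l" if "inv \<sigma> l = i \<or> inv \<sigma> l = j"
    using that ji valley permutes_inverses(1)[OF perm, of l] by auto
  then show "l < inv swapped l \<longleftrightarrow> l < inv \<sigma> l" "inv swapped l < l \<longleftrightarrow> inv \<sigma> l < l"
    by (auto simp: inv_swapped transpose_def)
qed

lemma swapped_cycle_types:
  "cpeaks n swapped = cpeaks n \<sigma>" "cvals n swapped = cvals n \<sigma>"
  "cdrises n swapped = cdrises n \<sigma>" "cdfalls n swapped = cdfalls n \<sigma>"
  "fixes_of n swapped = fixes_of n \<sigma>"
  by (simp_all add: cpeaks_def cvals_def cdrises_def cdfalls_def fixes_of_def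
      swapped_less_iff inv_swapped_less_iff)

lemma i_cvals: "i \<in> cvals n \<sigma>"
  and i_not: "i \<notin> cpeaks n \<sigma>" "i \<notin> cdrises n \<sigma>" "i \<notin> cdfalls n \<sigma>" "i \<notin> fixes_of n \<sigma>"
  using i_range valley by (auto simp: cvals_def cpeaks_def cdrises_def cdfalls_def fixes_of_def)

text \<open>For \<open>k\<close> above \<open>i\<close>, both \<open>i\<close> and \<open>j\<close>
  lie to its left and transposing them matches the covering arcs. For \<open>k\<close> at most
  \<open>i\<close>, only the arc from \<open>j\<close> can change, and both of its possible ends
  exceed \<open>i\<close>.\<close>

lemma swapped_cover: "card {l. l < k \<and> k < swapped l} = card {l. l < k \<and> k < \<sigma> l}"
proof (cases "i < k")
  case True
  show ?thesis
    by (rule bij_betw_same_card[of "transpose i j"],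
        rule bij_betwI[where g = "transpose i j"])
      (use True ji in \<open>auto simp: swapped_def transpose_def\<close>)
next
  case False
  then have "{l. l < k \<and> k < swapped l} = {l. l < k \<and> k < \<sigma> l}"
    using ji valley by (auto simp: swapped_cases)
  then show ?thesis by simp
qed

text \<open>Since these valleys survive the exchange, choosing the least one gives the same choice
  before and after.\<close>

lemma single_cover_valley_swapped: "single_cover_valley swapped k = single_cover_valley \<sigma> k"
  by (simp add: single_cover_valley_def swapped_less_iff inv_swapped_less_iff swapped_cover)

text \<open>The hypotheses of the locale are preserved by the exchange. Hence a one-sided fact about
  \<open>swapped\<close> yields its converse by a second exchange.\<close>

lemma swapped_valley_swap: "valley_swap n swapped i j"
proof
  show "swapped permutes {1..n}" by (rule swapped_permutes)
  show "i < swapped i" "i < inv swapped i"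
    using valley by (simp_all only: swapped_less_iff inv_swapped_less_iff)
  have "{l. l < i \<and> i < swapped l} = {l. l < i \<and> i < \<sigma> l}"
    using ji valley by (auto simp: swapped_cases)
  then show "{l. l < i \<and> i < swapped l} = {j}" by (simp add: cover)
qed

section \<open>Effect of the exchange on records and antirecords\<close>

text \<open>By \<open>below\<close>, \<open>j\<close> is the only earlier position that can carry a
  larger value.\<close>

lemma i_recs_iff: "i \<in> recs n \<sigma> \<longleftrightarrow> \<sigma> j < \<sigma> i"
proof
  assume "i \<in> recs n \<sigma>"
  then show "\<sigma> j < \<sigma> i" using j_range ji by (auto simp: recs_def)
next
  assume *: "\<sigma> j < \<sigma> i"
  have "\<sigma> l < \<sigma> i" if "l < i" for l
    using below[OF that] * valley by (cases "l = j") auto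
  then show "i \<in> recs n \<sigma>" using i_range by (simp add: recs_def)
qed

lemma j_recs: "j \<in> recs n \<sigma>"
proof -
  have "\<sigma> l < \<sigma> j" if "l < j" for l
    using below[of l] that ji by simp
  then show ?thesis using j_range by (simp add: recs_def)
qed

lemma not_arecs: "i \<notin> arecs n \<sigma>" "j \<notin> arecs n \<sigma>"
  using arecs_imp_ge[OF perm] valley ji by fastforce+

lemma recs_swapped_sub: "k \<in> recs n swapped" if "k \<in> recs n \<sigma>" "k \<noteq> i"
proof (cases "k = j")
  case True
  then show ?thesis using valley_swap.j_recs[OF swapped_valley_swap] by simp
next
  case False
  have *: "\<sigma> l < \<sigma> k" if "l \<in> {1..n}" "l < k" for l
    using \<open>k \<in> recs n \<sigma>\<close> that by (simp add: recs_def)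
  \<comment> \<open>A position strictly between \<open>j\<close> and \<open>i\<close> has a value
    below \<open>i\<close>, hence below the value at \<open>j\<close>, and is no record. So
    \<open>i\<close> and \<open>j\<close> lie on the same side of \<open>k\<close>, and the exchange
    cannot affect its record property.\<close>
  have "\<not> (j < k \<and> k < i)"
  proof
    assume "j < k \<and> k < i"
    then show False using *[OF j_range] below[of k] ji by auto
  qed
  then have "swapped l < swapped k" if "l \<in> {1..n}" "l < k" for l
    using *[OF that] *[OF i_range] *[OF j_range] that \<open>k \<noteq> i\<close> False ji j_range
    by (auto simp: swapped_cases)
  then show ?thesis using \<open>k \<in> recs n \<sigma>\<close> by (simp add: recs_def)
qed

text \<open>If \<open>k < i\<close>, its value lies below \<open>i\<close> and thus below both
  exchanged values; if \<open>k > i\<close>, neither \<open>i\<close> nor \<open>j\<close> occurs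
  among the later positions.\<close>

lemma arecs_swapped_sub: "k \<in> arecs n swapped" if "k \<in> arecs n \<sigma>"
proof -
  have k: "k \<noteq> i" "k \<noteq> j" using that not_arecs by auto
  have *: "\<sigma> k < \<sigma> l" if "l \<in> {1..n}" "k < l" for l
    using \<open>k \<in> arecs n \<sigma>\<close> that by (simp add: arecs_def)
  have "\<sigma> k < i" if "k < i" using below that k by simp
  then have "swapped k < swapped l" if "l \<in> {1..n}" "k < l" for l
    using *[OF that] that k ji valley by (fastforce simp: swapped_cases)
  then show ?thesis using \<open>k \<in> arecs n \<sigma>\<close> by (simp add: arecs_def)
qed

lemma swapped_swapped: "valley_swap.swapped swapped i j = \<sigma>"
  unfolding valley_swap.swapped_def[OF swapped_valley_swap]
  by (simp add: swapped_def comp_assoc)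

lemma arecs_swapped: "arecs n swapped = arecs n \<sigma>"
  using arecs_swapped_sub valley_swap.arecs_swapped_sub[OF swapped_valley_swap]
  by (auto simp: swapped_swapped)

lemma recs_swapped: "k \<noteq> i \<Longrightarrow> k \<in> recs n swapped \<longleftrightarrow> k \<in> recs n \<sigma>"
  using recs_swapped_sub valley_swap.recs_swapped_sub[OF swapped_valley_swap]
  by (auto simp: swapped_swapped)

text \<open>By \<open>i_recs_iff\<close> this depends on which of the two exchanged values is
  larger.\<close>

lemma i_recs_swapped: "i \<in> recs n swapped \<longleftrightarrow> i \<notin> recs n \<sigma>"
  using i_recs_iff valley_swap.i_recs_iff[OF swapped_valley_swap] \<sigma>_neq by auto

text \<open>To the right of \<open>i\<close>, transposing \<open>i\<close> and \<open>j\<close>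
  matches the arcs counted at \<open>k\<close>. To the left of \<open>i\<close>, every value except
  the one at \<open>j\<close> is below \<open>i\<close> while both exchanged values are above
  \<open>i\<close>, so the relevant comparisons keep their outcome. The nestings below behave
  alike.\<close>

lemma ucross_at_swapped: "ucross_at n k swapped = ucross_at n k \<sigma>" if "k \<noteq> i"
proof (cases "i < k")
  case True
  then show ?thesis
    unfolding ucross_at_def
    by (intro bij_betw_same_card[of "transpose i j"]
        bij_betwI[where g = "transpose i j"])
      (use ji i_range j_range in \<open>auto simp: swapped_def transpose_def\<close>)
next
  case False
  with that have "k < i" by simp
  have "k < swapped l \<and> swapped l < swapped k \<longleftrightarrow> k < \<sigma> l \<and> \<sigma> l < \<sigma> k" if "l < k" for l
  proof (cases "k = j")
    case True
    then show ?thesis using below[of l] that ji valley by (auto simp: swapped_cases)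
  next
    case False
    then show ?thesis using below[of k] \<open>k < i\<close> that ji valley by (auto simp: swapped_cases)
  qed
  then have "{l \<in> {1..n}. l < k \<and> k < swapped l \<and> swapped l < swapped k} =
      {l \<in> {1..n}. l < k \<and> k < \<sigma> l \<and> \<sigma> l < \<sigma> k}" by blast
  then show ?thesis by (simp add: ucross_at_def)
qed

lemma unest_at_swapped: "unest_at n k swapped = unest_at n k \<sigma>" if "k \<noteq> i"
proof (cases "i < k")
  case True
  then show ?thesis
    unfolding unest_at_def
    by (intro bij_betw_same_card[of "transpose i j"]
        bij_betwI[where g = "transpose i j"])
      (use ji i_range j_range in \<open>auto simp: swapped_def transpose_def\<close>)
next
  case False
  with that have "k < i" by simp
  have "k < swapped k \<and> swapped k < swapped l \<longleftrightarrow> k < \<sigma> k \<and> \<sigma> k < \<sigma> l" if "l < k" for l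
  proof (cases "k = j")
    case True
    then show ?thesis using below[of l] that ji valley by (auto simp: swapped_cases)
  next
    case False
    then show ?thesis using below[of k] \<open>k < i\<close> that ji valley by (auto simp: swapped_cases)
  qed
  then have "{l \<in> {1..n}. l < k \<and> k < swapped k \<and> swapped k < swapped l} =
      {l \<in> {1..n}. l < k \<and> k < \<sigma> k \<and> \<sigma> k < \<sigma> l}" by blast
  then show ?thesis by (simp add: unest_at_def)
qed

text \<open>Only falling arcs take part in lower crossings, whereas \<open>i\<close> and
  \<open>j\<close> start rising arcs before and after the exchange. The same applies to lower
  nestings.\<close>

lemma lcross_at_swapped: "lcross_at n k swapped = lcross_at n k \<sigma>"
proof -
  have "{l \<in> {1..n}. l > k \<and> k > swapped l \<and> swapped l > swapped k} =
      {l \<in> {1..n}. l > k \<and> k > \<sigma> l \<and> \<sigma> l > \<sigma> k}"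
    using ji valley by (auto simp: swapped_cases)
  then show ?thesis by (simp add: lcross_at_def)
qed

lemma lnest_at_swapped: "lnest_at n k swapped = lnest_at n k \<sigma>"
proof -
  have "{l \<in> {1..n}. l > k \<and> k > swapped k \<and> swapped k > swapped l} =
      {l \<in> {1..n}. l > k \<and> k > \<sigma> k \<and> \<sigma> k > \<sigma> l}"
    using ji valley by (auto simp: swapped_cases)
  then show ?thesis by (simp add: lnest_at_def)
qed

lemma ucross_at_i: "ucross_at n i \<sigma> = (if \<sigma> j < \<sigma> i then 1 else 0)"
proof -
  have "{l \<in> {1..n}. l < i \<and> i < \<sigma> l \<and> \<sigma> l < \<sigma> i} =
      {l \<in> {l. l < i \<and> i < \<sigma> l}. l \<in> {1..n} \<and> \<sigma> l < \<sigma> i}" by auto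
  also have "\<dots> = (if \<sigma> j < \<sigma> i then {j} else {})"
    unfolding cover using j_range by auto
  finally show ?thesis by (simp add: ucross_at_def)
qed

lemma unest_at_i: "unest_at n i \<sigma> = (if \<sigma> i < \<sigma> j then 1 else 0)"
proof -
  have "{l \<in> {1..n}. l < i \<and> i < \<sigma> i \<and> \<sigma> i < \<sigma> l} =
      {l \<in> {l. l < i \<and> i < \<sigma> l}. l \<in> {1..n} \<and> \<sigma> i < \<sigma> l}" using valley by auto
  also have "\<dots> = (if \<sigma> i < \<sigma> j then {j} else {})"
    unfolding cover using j_range by auto
  finally show ?thesis by (simp add: unest_at_def)
qed

lemma ucross_at_i_flips: "even (ucross_at n i swapped) \<longleftrightarrow> odd (ucross_at n i \<sigma>)"
  using ucross_at_i valley_swap.ucross_at_i[OF swapped_valley_swap] \<sigma>_neq by auto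

lemma unest_at_i_flips: "even (unest_at n i swapped) \<longleftrightarrow> odd (unest_at n i \<sigma>)"
  using unest_at_i valley_swap.unest_at_i[OF swapped_valley_swap] \<sigma>_neq by auto

lemma even_sum_flips:
  fixes f g :: "nat \<Rightarrow> nat"
  assumes "finite A" "i \<in> A" "\<And>k. k \<noteq> i \<Longrightarrow> f k = g k" "even (f i) \<longleftrightarrow> odd (g i)"
  shows "even (sum f A) \<longleftrightarrow> odd (sum g A)"
proof -
  have "sum f A = f i + sum g (A - {i})" "sum g A = g i + sum g (A - {i})"
    using assms(1-3) by (auto simp: sum.remove intro!: sum.cong)
  with assms(4) show ?thesis by auto
qed

lemma even_card_flips:
  assumes "finite A" "i \<in> A" "\<And>k. k \<noteq> i \<Longrightarrow> k \<in> S \<longleftrightarrow> k \<in> T" "i \<in> S \<longleftrightarrow> i \<notin> T"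
  shows "even (card (A \<inter> S)) \<longleftrightarrow> odd (card (A \<inter> T))"
proof -
  have "card (A \<inter> X) = (\<Sum>k\<in>A. if k \<in> X then 1 else 0)" for X
    using assms(1) by (simp add: sum.If_cases Int_def)
  then show ?thesis
    using even_sum_flips[OF assms(1,2), of "\<lambda>k. if k \<in> S then 1 else 0" "\<lambda>k. if k \<in> T then 1 else 0"]
      assms(3,4) by simp
qed

lemma ucross_flips: "even (ucross n swapped) \<longleftrightarrow> odd (ucross n \<sigma>)"
  and unest_flips: "even (unest n swapped) \<longleftrightarrow> odd (unest n \<sigma>)"
  unfolding ucross_def unest_def
  using i_range ucross_at_swapped unest_at_swapped ucross_at_i_flips unest_at_i_flips
  by (intro even_sum_flips; simp)+

lemma ucrosscval_flips: "even (ucrosscval n swapped) \<longleftrightarrow> odd (ucrosscval n \<sigma>)"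
  and unestcval_flips: "even (unestcval n swapped) \<longleftrightarrow> odd (unestcval n \<sigma>)"
  unfolding ucrosscval_def unestcval_def swapped_cycle_types
  using i_cvals ucross_at_swapped unest_at_swapped ucross_at_i_flips unest_at_i_flips
  by (intro even_sum_flips; simp add: cvals_def)+

lemma lcross_swapped: "lcross n swapped = lcross n \<sigma>"
  and lnest_swapped: "lnest n swapped = lnest n \<sigma>"
  by (simp_all add: lcross_def lnest_def lcross_at_swapped lnest_at_swapped)

lemma nrcval_flips: "even (nrcval n swapped) \<longleftrightarrow> odd (nrcval n \<sigma>)"
  unfolding nrcval_def swapped_cycle_types
  by (rule even_card_flips)
    (use i_cvals i_range not_arecs recs_swapped i_recs_swapped arecs_swapped
      in \<open>auto simp: nrars_def cvals_def\<close>)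

lemma ereccval_flips: "even (ereccval n swapped) \<longleftrightarrow> odd (ereccval n \<sigma>)"
  unfolding ereccval_def swapped_cycle_types
  by (rule even_card_flips)
    (use i_cvals i_range not_arecs recs_swapped i_recs_swapped arecs_swapped
      in \<open>auto simp: erecs_def cvals_def\<close>)

lemma swapped_Int:
  assumes "i \<notin> A"
  shows "A \<inter> erecs n swapped = A \<inter> erecs n \<sigma>" "A \<inter> earecs n swapped = A \<inter> earecs n \<sigma>"
    "A \<inter> nrars n swapped = A \<inter> nrars n \<sigma>"
proof -
  have "k \<in> recs n swapped \<longleftrightarrow> k \<in> recs n \<sigma>" if "k \<in> A" for k
    using assms that recs_swapped[of k] by metis
  then show "A \<inter> erecs n swapped = A \<inter> erecs n \<sigma>" "A \<inter> earecs n swapped = A \<inter> earecs n \<sigma>"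
    "A \<inter> nrars n swapped = A \<inter> nrars n \<sigma>"
    unfolding erecs_def earecs_def nrars_def arecs_swapped by blast+
qed

lemma swapped_record_stats:
  "eareccpeak n swapped = eareccpeak n \<sigma>" "eareccdfall n swapped = eareccdfall n \<sigma>"
  "ereccdrise n swapped = ereccdrise n \<sigma>" "nrcpeak n swapped = nrcpeak n \<sigma>"
  "nrcdrise n swapped = nrcdrise n \<sigma>" "nrcdfall n swapped = nrcdfall n \<sigma>"
  "nrfix n swapped = nrfix n \<sigma>" "cdrise n swapped = cdrise n \<sigma>" "cdfall n swapped = cdfall n \<sigma>"
  by (simp_all add: eareccpeak_def eareccdfall_def ereccdrise_def nrcpeak_def nrcdrise_def
      nrcdfall_def nrfix_def cdrise_def cdfall_def swapped_cycle_types swapped_Int i_not)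

text \<open>The summand at a fixed point is the number of arcs over it, which
  \<open>swapped_cover\<close> preserves.\<close>

lemma psnest_swapped: "psnest n swapped = psnest n \<sigma>"
proof -
  have "{l \<in> {1..n}. l < k \<and> \<rho> l > k} = {l. l < k \<and> k < \<rho> l}" if "\<rho> permutes {1..n}" for \<rho> k
    using permutes_not_in[OF that] by (metis (no_types, lifting) less_asym)
  then show ?thesis
    using perm swapped_permutes
    by (simp add: psnest_def swapped_cycle_types swapped_cover)
qed

text \<open>Composition with a transposition changes the sign, hence the parity of the number of
  cycle minima, while the fixed points among them stay the same.\<close>

lemma minval_flips: "even (minval n swapped) \<longleftrightarrow> odd (minval n \<sigma>)"
proof -
  have "permutation \<sigma>"
    using perm permutes_imp_permutation by (metis finite_atLeastAtMost)
  then have "sign swapped = - sign \<sigma>"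
    using ji by (simp add: swapped_def sign_compose sign_swap_id permutation_swap_id)
  then have "(- 1 :: int) ^ (n + card (cycle_minima n swapped)) = - ((- 1) ^ (n + card (cycle_minima n \<sigma>)))"
    using sign_eq_cycle_minima[OF perm] sign_eq_cycle_minima[OF swapped_permutes] by simp
  then have "even (card (cycle_minima n swapped)) \<longleftrightarrow> odd (card (cycle_minima n \<sigma>))"
    by (auto simp: minus_one_power_iff split: if_splits)
  then show ?thesis
    using card_cycle_minima[OF perm] card_cycle_minima[OF swapped_permutes]
    by (auto simp: swapped_cycle_types)
qed

text \<open>The total number of valleys is unchanged, so the parity moves together with that of
  \<open>minval\<close>.\<close>

lemma nminval_flips: "even (nminval n swapped) \<longleftrightarrow> odd (nminval n \<sigma>)"
proof -
  have *: "card (cvals n \<rho>) = minval n \<rho> + nminval n \<rho>" for \<rho>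
  proof -
    have "finite (cvals n \<rho>)" by (simp add: cvals_def)
    then show ?thesis
      unfolding minval_def nminval_def by (subst card_Un_disjoint[symmetric]) (auto intro: arg_cong[where f = card])
  qed
  show ?thesis
    using *[of \<sigma>] *[of swapped] minval_flips by (metis even_add swapped_cycle_types(2))
qed

end

section \<open>The exchange as an involution off the permutations of height at most one\<close>

text \<open>Only rising arcs are counted over each gap; \<open>permutes_card_crossing\<close> gives
  the same bound for the falling ones.\<close>

definition low_perms :: "nat \<Rightarrow> (nat \<Rightarrow> nat) set" where
  "low_perms n = {\<sigma> \<in> perms n. \<forall>k. card {l. l \<le> k \<and> k < \<sigma> l} \<le> 1}"

lemma finite_perms: "finite (perms n)"
  by (simp add: perms_def finite_permutations)

lemma finite_low_perms: "finite (low_perms n)"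
  by (simp add: low_perms_def finite_perms)

text \<open>A valley under one arc starts a second arc over the gap to its right. Conversely, moving
  from left to right, the height can first reach two only at a valley lying under exactly one
  arc.\<close>

lemma low_perms_iff_no_single_cover_valley:
  assumes "\<sigma> \<in> perms n"
  shows "\<sigma> \<in> low_perms n \<longleftrightarrow> (\<forall>i. \<not> single_cover_valley \<sigma> i)"
proof
  assume low: "\<sigma> \<in> low_perms n"
  show "\<forall>i. \<not> single_cover_valley \<sigma> i"
  proof (intro allI notI)
    fix i assume "single_cover_valley \<sigma> i"
    then have i: "i < \<sigma> i" and c: "card {l. l < i \<and> i < \<sigma> l} = 1"
      by (simp_all add: single_cover_valley_def)
    have "{l. l \<le> i \<and> i < \<sigma> l} = insert i {l. l < i \<and> i < \<sigma> l}"
      using i by auto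
    then have "card {l. l \<le> i \<and> i < \<sigma> l} = 2" using c by simp
    then show False using low by (auto simp: low_perms_def dest!: spec[of _ i])
  qed
next
  assume none: "\<forall>i. \<not> single_cover_valley \<sigma> i"
  have perm: "\<sigma> permutes {1..n}" using assms by (simp add: perms_def)
  have "card {l. l \<le> k \<and> k < \<sigma> l} \<le> 1" for k
  proof (induction k)
    case 0
    have "{l. l \<le> 0 \<and> 0 < \<sigma> l} = {}"
      using permutes_not_in[OF perm, of 0] by (auto intro!: gr0I)
    then show ?case by (simp only: card.empty le0)
  next
    case (Suc k)
    let ?A = "{l. l < Suc k \<and> Suc k < \<sigma> l}" and ?B = "{l. l \<le> k \<and> k < \<sigma> l}"
    have sub: "?A \<subseteq> ?B" and fin: "finite ?B" by auto
    then have cA: "card ?A \<le> 1" using Suc.IH card_mono[of ?B ?A] by simp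
    show ?case
    proof (cases "Suc k < \<sigma> (Suc k) \<and> card ?A = 1")
      case True
      \<comment> \<open>The arc over the gap before \<open>Suc k\<close> continues past
        \<open>Suc k\<close>, so no rising arc ends there and its preimage must lie above
        it.\<close>
      then have "?A = ?B" using sub fin Suc.IH card_seteq[of ?B ?A] by simp
      have "inv \<sigma> (Suc k) \<noteq> Suc k"
        using True permutes_inverses(1)[OF perm, of "Suc k"] by (metis less_irrefl)
      moreover have "\<not> inv \<sigma> (Suc k) < Suc k"
      proof
        assume "inv \<sigma> (Suc k) < Suc k"
        then have "inv \<sigma> (Suc k) \<in> ?B" using permutes_inverses(1)[OF perm, of "Suc k"] by simp
        then have "inv \<sigma> (Suc k) \<in> ?A" using \<open>?A = ?B\<close> by simp
        then show False using permutes_inverses(1)[OF perm, of "Suc k"] by simp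
      qed
      ultimately have "single_cover_valley \<sigma> (Suc k)"
        using True by (simp add: single_cover_valley_def)
      with none show ?thesis by simp
    next
      case False
      have "{l. l \<le> Suc k \<and> Suc k < \<sigma> l} = ?A \<union> (if Suc k < \<sigma> (Suc k) then {Suc k} else {})"
        by (auto simp: le_less)
      then have "card {l. l \<le> Suc k \<and> Suc k < \<sigma> l} \<le>
          card ?A + card (if Suc k < \<sigma> (Suc k) then {Suc k} else {})"
        using card_Un_le by metis
      then show ?thesis using False cA by (cases "Suc k < \<sigma> (Suc k)") simp_all
    qed
  qed
  then show "\<sigma> \<in> low_perms n" using assms by (simp add: low_perms_def)
qed

text \<open>The least valley is taken as a canonical choice that the exchange itself does not alter;
  \<open>THE\<close> recovers the start of the arc over it.\<close>

definition valley_flip :: "(nat \<Rightarrow> nat) \<Rightarrow> nat \<Rightarrow> nat" where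
  "valley_flip \<sigma> =
    (let i = (LEAST i. single_cover_valley \<sigma> i)
     in \<sigma> \<circ> transpose i (THE j. {l. l < i \<and> i < \<sigma> l} = {j}))"

lemma valley_flip:
  assumes "\<sigma> \<in> perms n - low_perms n"
  obtains i j where "valley_swap n \<sigma> i j" "valley_flip \<sigma> = valley_swap.swapped \<sigma> i j"
    "valley_flip \<sigma> \<in> perms n - low_perms n" "valley_flip (valley_flip \<sigma>) = \<sigma>"
proof -
  define i where "i = (LEAST i. single_cover_valley \<sigma> i)"
  have "\<exists>i. single_cover_valley \<sigma> i"
    using assms low_perms_iff_no_single_cover_valley by blast
  then have scv: "single_cover_valley \<sigma> i"
    unfolding i_def by (rule LeastI_ex)
  then obtain j where j: "{l. l < i \<and> i < \<sigma> l} = {j}"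
    by (auto simp: single_cover_valley_def card_1_singleton_iff)
  interpret valley_swap n \<sigma> i j
    using assms scv j by unfold_locales (auto simp: perms_def single_cover_valley_def)
  \<comment> \<open>Stated for every \<rho> with the same single-cover valleys, so that it computes
    the flip of \<sigma> and also the flip of the result.\<close>
  have flip: "valley_flip \<rho> = \<rho> \<circ> transpose i j"
    if "valley_swap n \<rho> i j" "\<And>k. single_cover_valley \<rho> k = single_cover_valley \<sigma> k" for \<rho>
  proof -
    have "(THE j. {l. l < i \<and> i < \<rho> l} = {j}) = j"
      using valley_swap.cover[OF that(1)] by auto
    then show ?thesis using that(2) by (simp add: valley_flip_def Let_def i_def[symmetric])
  qed
  have 1: "valley_flip \<sigma> = swapped"
    using flip[of \<sigma>] by (simp add: swapped_def valley_swap_axioms)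
  moreover have "valley_flip swapped = \<sigma>"
    using flip[of swapped] swapped_valley_swap single_cover_valley_swapped
    by (simp add: swapped_def comp_assoc)
  moreover have "swapped \<in> perms n" using swapped_permutes by (simp add: perms_def)
  moreover have "swapped \<notin> low_perms n"
    using low_perms_iff_no_single_cover_valley[OF \<open>swapped \<in> perms n\<close>]
      single_cover_valley_swapped scv by blast
  ultimately show ?thesis using that valley_swap_axioms by simp
qed

lemma sum_perms_eq_sum_low_perms:
  assumes "\<And>\<sigma> i j. valley_swap n \<sigma> i j \<Longrightarrow> even (S (valley_swap.swapped \<sigma> i j)) \<longleftrightarrow> odd (S \<sigma>)"
  shows "(\<Sum>\<sigma>\<in>perms n. (- 1 :: int) ^ S \<sigma>) = (\<Sum>\<sigma>\<in>low_perms n. (- 1) ^ S \<sigma>)"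
proof -
  have "(\<Sum>\<sigma>\<in>perms n - low_perms n. (- 1 :: int) ^ S \<sigma>) = 0"
  proof (rule sum_eq_0_if_sign_reversing[of _ valley_flip])
    fix \<sigma> assume \<sigma>: "\<sigma> \<in> perms n - low_perms n"
    show "valley_flip \<sigma> \<in> perms n - low_perms n" "valley_flip (valley_flip \<sigma>) = \<sigma>"
      using valley_flip[OF \<sigma>] by metis+
    obtain i j where "valley_swap n \<sigma> i j" "valley_flip \<sigma> = valley_swap.swapped \<sigma> i j"
      using valley_flip[OF \<sigma>] by metis
    then show "(- 1 :: int) ^ S (valley_flip \<sigma>) = - ((- 1) ^ S \<sigma>)"
      using assms[of \<sigma> i j] by (auto simp: minus_one_power_iff)
  qed
  then show ?thesis
    using sum.subset_diff[of "low_perms n" "perms n" "\<lambda>\<sigma>. (- 1 :: int) ^ S \<sigma>"] finite_perms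
    by (simp add: low_perms_def)
qed

subsection \<open>Permutations of height at most one\<close>

text \<open>Both transposed points lie above \<open>k\<close>.\<close>

lemma transpose_Suc_compare:
  assumes "k < n"
  shows "transpose n (Suc n) x < k \<longleftrightarrow> x < k" "k < transpose n (Suc n) x \<longleftrightarrow> k < x"
    "transpose n (Suc n) x = k \<longleftrightarrow> x = k" "transpose n (Suc n) k = k"
  using assms by (auto simp: transpose_def)

lemma perms_Suc_iff: "\<sigma> \<in> perms n \<longleftrightarrow> \<sigma> \<in> perms (Suc n) \<and> \<sigma> (Suc n) = Suc n"
proof
  assume "\<sigma> \<in> perms n"
  then show "\<sigma> \<in> perms (Suc n) \<and> \<sigma> (Suc n) = Suc n"
    by (auto simp: perms_def permutes_not_in elim!: permutes_subset)
next
  assume "\<sigma> \<in> perms (Suc n) \<and> \<sigma> (Suc n) = Suc n"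
  then show "\<sigma> \<in> perms n"
    by (auto simp: perms_def le_Suc_eq elim!: permutes_superset)
qed

lemma perms_Suc_transpose:
  assumes "n \<ge> 1"
  shows "\<sigma> \<in> perms (Suc n) \<Longrightarrow> \<sigma> \<circ> transpose n (Suc n) \<in> perms (Suc n)"
    "\<sigma> \<in> perms (Suc n) \<Longrightarrow> transpose n (Suc n) \<circ> \<sigma> \<in> perms (Suc n)"
  using assms permutes_swap_id[of n "{1..Suc n}" "Suc n"]
  by (auto simp: perms_def intro: permutes_compose)

lemma perms_above:
  assumes "\<sigma> \<in> perms n" "l \<le> k" "k < \<sigma> l"
  shows "k < n"
proof -
  have \<sigma>: "\<sigma> permutes {1..n}" using assms by (simp add: perms_def)
  have "l \<in> {1..n}" using permutes_not_in[OF \<sigma>, of l] assms by (metis not_less)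
  then show ?thesis using permutes_bounds[OF \<sigma>, of l] assms by simp
qed

text \<open>Over the gap after \<open>n\<close> only the arc into \<open>Suc n\<close> can pass, and
  no arc crosses a later gap.\<close>

lemma low_perms_Suc_iff:
  assumes "\<sigma> \<in> perms (Suc n)"
  shows "\<sigma> \<in> low_perms (Suc n) \<longleftrightarrow> (\<forall>k<n. card {l. l \<le> k \<and> k < \<sigma> l} \<le> 1)"
proof -
  have \<sigma>: "\<sigma> permutes {1..Suc n}" using assms by (simp add: perms_def)
  have "card {l. l \<le> k \<and> k < \<sigma> l} \<le> 1" if "\<not> k < n" for k
  proof -
    have "l = inv \<sigma> (Suc n)" if l: "l \<le> k" "k < \<sigma> l" for l
    proof -
      have "k < Suc n" using assms l by (rule perms_above)
      then have "\<sigma> l \<le> Suc n"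
        using permutes_bounds[OF \<sigma>, of l] l(1) by simp
      then have "\<sigma> l = Suc n" using l \<open>\<not> k < n\<close> by simp
      then show ?thesis using permutes_inverses[OF \<sigma>] by metis
    qed
    then have "{l. l \<le> k \<and> k < \<sigma> l} \<subseteq> {inv \<sigma> (Suc n)}" by auto
    then show ?thesis using card_mono[of "{inv \<sigma> (Suc n)}"] by simp
  qed
  then show ?thesis using assms unfolding low_perms_def by blast
qed

text \<open>The transposed points lie on the same side of every gap that still has to be
  checked.\<close>

lemma low_perms_Suc_transpose:
  assumes "n \<ge> 1" "\<sigma> \<in> low_perms (Suc n)"
  shows "\<sigma> \<circ> transpose n (Suc n) \<in> low_perms (Suc n)"
    "transpose n (Suc n) \<circ> \<sigma> \<in> low_perms (Suc n)"
proof -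
  have \<sigma>: "\<sigma> \<in> perms (Suc n)" using assms by (simp add: low_perms_def)
  have *: "card {l. l \<le> k \<and> k < \<sigma> l} \<le> 1" if "k < n" for k
    using assms \<sigma> that by (simp add: low_perms_Suc_iff)
  have "{l. l \<le> k \<and> k < (\<sigma> \<circ> transpose n (Suc n)) l} = {l. l \<le> k \<and> k < \<sigma> l}" if "k < n" for k
    using that by (auto simp: transpose_def)
  then show "\<sigma> \<circ> transpose n (Suc n) \<in> low_perms (Suc n)"
    using perms_Suc_transpose(1)[OF assms(1) \<sigma>] * by (simp add: low_perms_Suc_iff)
  have "{l. l \<le> k \<and> k < (transpose n (Suc n) \<circ> \<sigma>) l} = {l. l \<le> k \<and> k < \<sigma> l}" if "k < n" for k
    using that by (simp add: transpose_Suc_compare)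
  then show "transpose n (Suc n) \<circ> \<sigma> \<in> low_perms (Suc n)"
    using perms_Suc_transpose(2)[OF assms(1) \<sigma>] * by (simp add: low_perms_Suc_iff)
qed

lemma low_perms_restrict: "\<sigma> \<in> low_perms n \<longleftrightarrow> \<sigma> \<in> low_perms (Suc n) \<and> \<sigma> (Suc n) = Suc n"
  using perms_Suc_iff[of \<sigma> n] by (auto simp: low_perms_def)

lemma low_perms_inj:
  assumes "\<sigma> \<in> low_perms n" "l \<le> k" "m \<le> k" "k < \<sigma> l" "k < \<sigma> m"
  shows "l = m"
proof -
  have "card {l. l \<le> k \<and> k < \<sigma> l} \<le> Suc 0" using assms by (simp add: low_perms_def)
  moreover have "finite {l. l \<le> k \<and> k < \<sigma> l}" by simp
  ultimately show ?thesis using assms(2-) card_le_Suc0_iff_eq by blast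
qed

lemma low_perms_inj':
  assumes "\<sigma> \<in> low_perms n" "k < l" "k < m" "\<sigma> l \<le> k" "\<sigma> m \<le> k"
  shows "l = m"
proof -
  have \<sigma>: "\<sigma> permutes {1..n}" using assms by (simp add: low_perms_def perms_def)
  have "card {l. l \<le> k \<and> k < \<sigma> l} \<le> Suc 0" using assms by (simp add: low_perms_def)
  then have "card {l. k < l \<and> \<sigma> l \<le> k} \<le> Suc 0"
    using permutes_card_crossing[OF \<sigma>] by simp
  moreover have "finite {l. k < l \<and> \<sigma> l \<le> k}"
    by (rule finite_subset[of _ "\<sigma> -` {..k}"])
      (auto intro!: finite_vimageI permutes_inj[OF \<sigma>])
  ultimately show ?thesis using assms(2-) card_le_Suc0_iff_eq by blast
qed

text \<open>Otherwise the arcs into \<open>n\<close> and \<open>Suc n\<close> would both start below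
  \<open>n\<close>, and two arcs would cross the gap between \<open>n - 1\<close> and
  \<open>n\<close>.\<close>

lemma low_perms_Suc_cases:
  assumes "\<sigma> \<in> low_perms (Suc n)" "n \<ge> 1"
  shows "\<sigma> (Suc n) = Suc n \<or> \<sigma> n = Suc n \<or> \<sigma> (Suc n) = n \<or> \<sigma> n = n"
proof (rule ccontr)
  assume neg: "\<not> ?thesis"
  have \<sigma>: "\<sigma> permutes {1..Suc n}" using assms by (simp add: low_perms_def perms_def)
  have *: "inv \<sigma> x \<le> n - 1 \<and> \<sigma> (inv \<sigma> x) = x" if "x = n \<or> x = Suc n" for x
  proof -
    have "\<sigma> (inv \<sigma> x) = x" using permutes_inverses[OF \<sigma>] by simp
    moreover have "inv \<sigma> x \<le> Suc n"
      using that permutes_bounds[OF permutes_inv[OF \<sigma>], of x] by auto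
    moreover have "inv \<sigma> x \<noteq> n" "inv \<sigma> x \<noteq> Suc n"
      using neg \<open>\<sigma> (inv \<sigma> x) = x\<close> that by metis+
    ultimately show ?thesis by auto
  qed
  have "inv \<sigma> n = inv \<sigma> (Suc n)"
    by (rule low_perms_inj[OF assms(1), of _ "n - 1"]) (use * assms(2) in auto)
  then show False using *[of n] *[of "Suc n"] by simp
qed

section \<open>Doubling recursion for the signed count at height at most one\<close>

text \<open>One induction serves double rises, double falls and nested fixed points. The premises
  say how the counted property \<open>P\<close> reacts when the size grows: it is unaffected below
  \<open>n\<close>, absent from \<open>n\<close> on for the smaller permutation, and at
  \<open>n\<close> governed by whether the smaller permutation moves \<open>n\<close>.\<close>

lemma sum_low_perms:
  fixes P :: "(nat \<Rightarrow> nat) \<Rightarrow> nat \<Rightarrow> bool"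
  assumes local_right: "\<And>n \<sigma> k. \<sigma> \<in> perms (Suc n) \<Longrightarrow> k < n \<Longrightarrow> P (\<sigma> \<circ> transpose n (Suc n)) k = P \<sigma> k"
    and local_left: "\<And>n \<sigma> k. \<sigma> \<in> perms (Suc n) \<Longrightarrow> k < n \<Longrightarrow> P (transpose n (Suc n) \<circ> \<sigma>) k = P \<sigma> k"
    and bound: "\<And>n \<sigma> k. \<sigma> \<in> perms n \<Longrightarrow> k \<ge> n \<Longrightarrow> \<not> P \<sigma> k"
    and new_valley: "\<And>n \<sigma>. \<sigma> \<in> perms n \<Longrightarrow> \<sigma> n = n \<Longrightarrow> \<not> P (\<sigma> \<circ> transpose n (Suc n)) n"
    and one_of_three: "\<And>n \<sigma>. \<sigma> \<in> perms n \<Longrightarrow> \<sigma> n \<noteq> n \<Longrightarrow>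
      of_bool (P (\<sigma> \<circ> transpose n (Suc n)) n) + of_bool (P (transpose n (Suc n) \<circ> \<sigma>) n) +
      of_bool (P (transpose n (Suc n) \<circ> \<sigma> \<circ> transpose n (Suc n)) n) = (1 :: nat)"
  shows "(\<Sum>\<sigma>\<in>low_perms n. (- 1 :: int) ^ card {k. P \<sigma> k}) = (if n = 0 then 1 else 2 ^ (n - 1))"
proof -
  define w :: "(nat \<Rightarrow> nat) \<Rightarrow> int" where "w \<sigma> = (- 1) ^ card {k. P \<sigma> k}" for \<sigma>
  have double: "sum w (low_perms (Suc n)) = 2 * sum w (low_perms n)" if n: "n \<ge> 1" for n
  proof -
    let ?t = "transpose n (Suc n)" and ?L = "low_perms (Suc n)"
    let ?N = "{\<sigma> \<in> low_perms n. \<sigma> n \<noteq> n}"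
    note lowt = low_perms_Suc_transpose[OF n]
    have w_eq: "w \<sigma> = (- 1) ^ card {k. k < n \<and> P \<sigma> k} * (if P \<sigma> n then - 1 else 1)"
      if "\<sigma> \<in> perms (Suc n)" for \<sigma>
    proof -
      have "k \<le> n" if "P \<sigma> k" for k
        using bound[OF \<open>\<sigma> \<in> perms (Suc n)\<close>, of k] that by (meson not_less_eq_eq)
      then have "{k. P \<sigma> k} = {k. k < n \<and> P \<sigma> k} \<union> (if P \<sigma> n then {n} else {})"
        by (auto simp: le_less)
      then show ?thesis by (simp add: w_def)
    qed
    have w_right: "w (\<tau> \<circ> ?t) = w \<tau> * (if P (\<tau> \<circ> ?t) n then - 1 else 1)"
      and w_left: "w (?t \<circ> \<tau>) = w \<tau> * (if P (?t \<circ> \<tau>) n then - 1 else 1)"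
      and w_both: "w (?t \<circ> \<tau> \<circ> ?t) = w \<tau> * (if P (?t \<circ> \<tau> \<circ> ?t) n then - 1 else 1)"
      if "\<tau> \<in> low_perms n" for \<tau>
    proof -
      have \<tau>: "\<tau> \<in> perms n" "\<tau> \<in> perms (Suc n)"
        using that perms_Suc_iff[of \<tau> n] by (auto simp: low_perms_def)
      note t = perms_Suc_transpose[OF n]
      have "\<not> P \<tau> n" using bound \<tau> by simp
      then have "w \<tau> = (- 1) ^ card {k. k < n \<and> P \<tau> k}" using w_eq \<tau> by simp
      then show "w (\<tau> \<circ> ?t) = w \<tau> * (if P (\<tau> \<circ> ?t) n then - 1 else 1)"
        "w (?t \<circ> \<tau>) = w \<tau> * (if P (?t \<circ> \<tau>) n then - 1 else 1)"
        "w (?t \<circ> \<tau> \<circ> ?t) = w \<tau> * (if P (?t \<circ> \<tau> \<circ> ?t) n then - 1 else 1)"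
        using w_eq t \<tau> by (simp_all add: local_right local_left cong: conj_cong)
    qed
    have invol: "(\<sigma> \<circ> ?t) \<circ> ?t = \<sigma>" "?t \<circ> (?t \<circ> \<sigma>) = \<sigma>"
      "?t \<circ> (?t \<circ> \<sigma> \<circ> ?t) \<circ> ?t = \<sigma>" for \<sigma> :: "nat \<Rightarrow> nat"
      by (simp_all add: fun_eq_iff)
    have t_eq: "?t x = n \<longleftrightarrow> x = Suc n" "?t x = Suc n \<longleftrightarrow> x = n" for x
      by (auto simp: transpose_def)
    have neq: "\<sigma> n \<noteq> \<sigma> (Suc n)" if "\<sigma> \<in> ?L" for \<sigma>
    proof -
      have "inj \<sigma>" using that by (auto simp: low_perms_def perms_def intro: permutes_inj)
      then show ?thesis by (simp add: inj_eq)
    qed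
    \<comment> \<open>With \<tau> in \<open>?F\<close>, these sets collect \<tau>,
      \<open>\<tau> \<circ> ?t\<close>, \<open>?t \<circ> \<tau>\<close> and
      \<open>?t \<circ> \<tau> \<circ> ?t\<close>. The inequations in \<open>?E\<close> and
      \<open>?H\<close> exclude every \<tau> fixing \<open>n\<close>, which would repeat elements of
      \<open>?D\<close> and \<open>?F\<close>.\<close>
    let ?F = "low_perms n" and ?D = "{\<sigma> \<in> ?L. \<sigma> n = Suc n}"
    let ?E = "{\<sigma> \<in> ?L. \<sigma> (Suc n) = n \<and> \<sigma> n \<noteq> Suc n}"
    let ?H = "{\<sigma> \<in> ?L. \<sigma> n = n \<and> \<sigma> (Suc n) \<noteq> Suc n}"
    have split: "?L = ?F \<union> (?D \<union> (?E \<union> ?H))"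
    proof (intro set_eqI iffI)
      fix \<sigma> assume "\<sigma> \<in> ?L"
      then show "\<sigma> \<in> ?F \<union> (?D \<union> (?E \<union> ?H))"
        using low_perms_Suc_cases[OF _ n, of \<sigma>] low_perms_restrict[of \<sigma> n] by auto
    next
      fix \<sigma> assume "\<sigma> \<in> ?F \<union> (?D \<union> (?E \<union> ?H))"
      then show "\<sigma> \<in> ?L" using low_perms_restrict[of \<sigma> n] by auto
    qed
    have disj: "?E \<inter> ?H = {}"
      by (auto dest!: neq)
    have disj': "?D \<inter> (?E \<union> ?H) = {}" by auto
    have disj'': "?F \<inter> (?D \<union> (?E \<union> ?H)) = {}"
      unfolding disjoint_iff
    proof (intro allI impI)
      fix \<sigma> assume "\<sigma> \<in> ?F"
      then show "\<sigma> \<notin> ?D \<union> (?E \<union> ?H)"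
        using low_perms_restrict[of \<sigma> n] neq[of \<sigma>] by auto
    qed
    have "sum w ?L = sum w (?F \<union> (?D \<union> (?E \<union> ?H)))"
      using split by (rule arg_cong)
    also have "\<dots> = sum w ?F + (sum w ?D + (sum w ?E + sum w ?H))"
      using disj disj' disj'' by (simp add: sum.union_disjoint finite_low_perms)
    also have "sum w ?D = (\<Sum>\<tau>\<in>?F. w (\<tau> \<circ> ?t))"
      by (rule sum.reindex_bij_witness[of _ "\<lambda>\<tau>. \<tau> \<circ> ?t" "\<lambda>\<tau>. \<tau> \<circ> ?t"])
        (use lowt invol low_perms_restrict[of _ n] in auto)
    also have "sum w ?E = (\<Sum>\<tau>\<in>?N. w (?t \<circ> \<tau>))"
    proof (rule sum.reindex_bij_witness[of _ "\<lambda>\<tau>. ?t \<circ> \<tau>" "\<lambda>\<tau>. ?t \<circ> \<tau>"])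
      fix \<sigma> assume "\<sigma> \<in> ?E"
      then show "?t \<circ> \<sigma> \<in> ?N"
        using lowt(2)[of \<sigma>] low_perms_restrict[of "?t \<circ> \<sigma>" n] t_eq by simp
    next
      fix \<tau> assume "\<tau> \<in> ?N"
      then show "?t \<circ> \<tau> \<in> ?E"
        using lowt(2)[of \<tau>] low_perms_restrict[of \<tau> n] t_eq by simp
    qed (simp_all only: invol)
    also have "sum w ?H = (\<Sum>\<tau>\<in>?N. w (?t \<circ> \<tau> \<circ> ?t))"
    proof (rule sum.reindex_bij_witness[of _ "\<lambda>\<tau>. ?t \<circ> \<tau> \<circ> ?t" "\<lambda>\<tau>. ?t \<circ> \<tau> \<circ> ?t"])
      fix \<sigma> assume "\<sigma> \<in> ?H"
      then show "?t \<circ> \<sigma> \<circ> ?t \<in> ?N"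
        using lowt(1)[OF lowt(2), of \<sigma>] low_perms_restrict[of "?t \<circ> \<sigma> \<circ> ?t" n] t_eq by simp
    next
      fix \<tau> assume "\<tau> \<in> ?N"
      then show "?t \<circ> \<tau> \<circ> ?t \<in> ?H"
        using lowt(1)[OF lowt(2), of \<tau>] low_perms_restrict[of \<tau> n] t_eq by simp
    qed (simp_all only: invol)
    also have "(\<Sum>\<tau>\<in>?F. w (\<tau> \<circ> ?t)) = (\<Sum>\<tau>\<in>?F - ?N. w (\<tau> \<circ> ?t)) + (\<Sum>\<tau>\<in>?N. w (\<tau> \<circ> ?t))"
      by (rule sum.subset_diff) (auto simp: finite_low_perms)
    also have "(\<Sum>\<tau>\<in>?F - ?N. w (\<tau> \<circ> ?t)) = (\<Sum>\<tau>\<in>?F - ?N. w \<tau>)"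
      by (rule sum.cong) (auto simp: w_right new_valley low_perms_def)
    also have "sum w ?F + ((\<Sum>\<tau>\<in>?F - ?N. w \<tau>) + (\<Sum>\<tau>\<in>?N. w (\<tau> \<circ> ?t)) +
        ((\<Sum>\<tau>\<in>?N. w (?t \<circ> \<tau>)) + (\<Sum>\<tau>\<in>?N. w (?t \<circ> \<tau> \<circ> ?t)))) =
        sum w ?F + ((\<Sum>\<tau>\<in>?F - ?N. w \<tau>) + (\<Sum>\<tau>\<in>?N. w (\<tau> \<circ> ?t) + w (?t \<circ> \<tau>) + w (?t \<circ> \<tau> \<circ> ?t)))"
      by (simp add: sum.distrib)
    \<comment> \<open>Exactly one of the three terms is \<open>- w \<tau>\<close> and the other two
      are \<open>w \<tau>\<close>.\<close>
    also have "(\<Sum>\<tau>\<in>?N. w (\<tau> \<circ> ?t) + w (?t \<circ> \<tau>) + w (?t \<circ> \<tau> \<circ> ?t)) = sum w ?N"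
    proof (rule sum.cong)
      fix \<tau> assume "\<tau> \<in> ?N"
      then have "\<tau> \<in> low_perms n" "\<tau> \<in> perms n" "\<tau> n \<noteq> n" by (auto simp: low_perms_def)
      then show "w (\<tau> \<circ> ?t) + w (?t \<circ> \<tau>) + w (?t \<circ> \<tau> \<circ> ?t) = w \<tau>"
        using one_of_three[of \<tau> n] unfolding w_right[OF \<open>\<tau> \<in> low_perms n\<close>]
          w_left[OF \<open>\<tau> \<in> low_perms n\<close>] w_both[OF \<open>\<tau> \<in> low_perms n\<close>]
        by (auto simp: of_bool_def split: if_splits)
    qed simp
    also have "(\<Sum>\<tau>\<in>?F - ?N. w \<tau>) + sum w ?N = sum w ?F"
      by (rule sum.subset_diff[symmetric]) (auto simp: finite_low_perms)
    finally show ?thesis by simp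
  qed
  have w_id: "w id = 1"
  proof -
    have "\<not> P id k" for k using bound[of id 0 k] by (simp add: perms_def permutes_id)
    then show ?thesis by (simp add: w_def)
  qed
  \<comment> \<open>Sizes 0 and 1 both admit only the identity. Doubling starts at size 1, whence
    the exponent \<open>n - 1\<close> and the separate value at 0.\<close>
  have base: "sum w (low_perms m) = 1" if "m \<le> 1" for m
  proof -
    have "perms m = {id}"
      using that by (cases m) (auto simp: perms_def permutes_id)
    moreover have "id \<in> low_perms m"
    proof -
      have "{l :: nat. l \<le> k \<and> k < id l} = {}" for k by auto
      then have "card {l :: nat. l \<le> k \<and> k < id l} \<le> 1" for k
        by (simp only: card.empty le0)
      with \<open>perms m = {id}\<close> show ?thesis unfolding low_perms_def by blast
    qed
    ultimately have "low_perms m = {id}" by (auto simp: low_perms_def)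
    moreover have "sum w {id} = w id" by simp
    ultimately show ?thesis by (simp only: w_id)
  qed
  have "sum w (low_perms (Suc m)) = 2 ^ m" for m
  proof (induction m)
    case 0
    then show ?case using base[of "Suc 0"] by simp
  next
    case (Suc m)
    then show ?case using double[of "Suc m"] by simp
  qed
  then show ?thesis
    unfolding w_def[symmetric] using base[of 0] by (cases n) simp_all
qed

section \<open>Signed counts of double rises, double falls and nested fixed points\<close>

lemma inv_comp_transpose:
  assumes "\<sigma> \<in> perms n"
  shows "inv (\<sigma> \<circ> transpose a b) x = transpose a b (inv \<sigma> x)"
    "inv (transpose a b \<circ> \<sigma>) x = inv \<sigma> (transpose a b x)"
proof -
  have "bij \<sigma>" using assms permutes_bij by (auto simp: perms_def)
  then show "inv (\<sigma> \<circ> transpose a b) x = transpose a b (inv \<sigma> x)"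
    "inv (transpose a b \<circ> \<sigma>) x = inv \<sigma> (transpose a b x)"
    by (simp_all add: o_inv_distrib)
qed

lemma perms_moved: "\<sigma> \<in> perms n \<Longrightarrow> \<sigma> k \<noteq> k \<Longrightarrow> k \<in> {1..n}"
  using permutes_not_in by (fastforce simp: perms_def)

lemma perms_inverses:
  assumes "\<sigma> \<in> perms n"
  shows "\<sigma> (inv \<sigma> x) = x" "inv \<sigma> (\<sigma> x) = x"
  using assms permutes_inverses by (auto simp: perms_def)

lemma inv_in_perms: "\<sigma> \<in> perms n \<Longrightarrow> inv \<sigma> \<in> perms n"
  by (simp add: perms_def permutes_inv)

lemma perms_top:
  assumes "\<sigma> \<in> perms n"
  shows "\<sigma> (Suc n) = Suc n" "inv \<sigma> (Suc n) = Suc n" "\<sigma> n \<le> n" "inv \<sigma> n \<le> n"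
    "inv \<sigma> n = n \<longleftrightarrow> \<sigma> n = n"
proof -
  have 1: "\<rho> (Suc n) = Suc n \<and> \<rho> n \<le> n" if "\<rho> \<in> perms n" for \<rho>
    using that permutes_not_in[of \<rho> "{1..n}" "Suc n"] permutes_bounds[of \<rho> n n]
    by (simp add: perms_def)
  show "\<sigma> (Suc n) = Suc n" "inv \<sigma> (Suc n) = Suc n" "\<sigma> n \<le> n" "inv \<sigma> n \<le> n"
    using 1[OF assms] 1[OF inv_in_perms[OF assms]] by auto
  show "inv \<sigma> n = n \<longleftrightarrow> \<sigma> n = n"
    using perms_inverses[OF assms] by metis
qed

lemma sum_low_perms_cdrise:
  "(\<Sum>\<sigma>\<in>low_perms n. (- 1 :: int) ^ card (cdrises n \<sigma>)) = (if n = 0 then 1 else 2 ^ (n - 1))"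
proof -
  let ?P = "\<lambda>\<sigma> k :: nat. inv \<sigma> k < k \<and> k < \<sigma> k"
  \<comment> \<open>Points outside the range are fixed and so never double rises. Dropping the range
    gives the size-free property that \<open>sum_low_perms\<close> expects.\<close>
  have "cdrises n \<sigma> = {k. ?P \<sigma> k}" if "\<sigma> \<in> low_perms n" for \<sigma>
    using that perms_moved[of \<sigma> n] by (fastforce simp: cdrises_def low_perms_def)
  then have "(\<Sum>\<sigma>\<in>low_perms n. (- 1 :: int) ^ card (cdrises n \<sigma>)) =
      (\<Sum>\<sigma>\<in>low_perms n. (- 1) ^ card {k. ?P \<sigma> k})"
    by (intro sum.cong) simp_all
  also have "\<dots> = (if n = 0 then 1 else 2 ^ (n - 1))"
  proof (rule sum_low_perms)
    fix n \<sigma> and k :: nat assume "\<sigma> \<in> perms (Suc n)" "k < n"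
    then show "?P (\<sigma> \<circ> transpose n (Suc n)) k = ?P \<sigma> k"
      "?P (transpose n (Suc n) \<circ> \<sigma>) k = ?P \<sigma> k"
      by (simp_all add: inv_comp_transpose transpose_Suc_compare)
  next
    fix n \<sigma> and k :: nat assume "\<sigma> \<in> perms n" "n \<le> k"
    then show "\<not> ?P \<sigma> k" using perms_above[of \<sigma> n k k] by auto
  next
    fix n \<sigma> assume \<sigma>: "\<sigma> \<in> perms n" "\<sigma> n = n"
    then show "\<not> ?P (\<sigma> \<circ> transpose n (Suc n)) n"
      using perms_top[OF \<sigma>(1)] by (simp add: inv_comp_transpose)
  next
    fix n \<sigma> assume \<sigma>: "\<sigma> \<in> perms n" "\<sigma> n \<noteq> n"
    note top = perms_top[OF \<sigma>(1)]
    have "\<sigma> n < n" "inv \<sigma> n < n" using top \<sigma>(2) by auto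
    then show "of_bool (?P (\<sigma> \<circ> transpose n (Suc n)) n) + of_bool (?P (transpose n (Suc n) \<circ> \<sigma>) n) +
      of_bool (?P (transpose n (Suc n) \<circ> \<sigma> \<circ> transpose n (Suc n)) n) = (1 :: nat)"
      using top inv_comp_transpose[OF \<sigma>(1)] by (simp add: transpose_def)
  qed
  finally show ?thesis .
qed

lemma sum_low_perms_cdfall:
  "(\<Sum>\<sigma>\<in>low_perms n. (- 1 :: int) ^ card (cdfalls n \<sigma>)) = (if n = 0 then 1 else 2 ^ (n - 1))"
proof -
  let ?P = "\<lambda>\<sigma> k :: nat. k < inv \<sigma> k \<and> \<sigma> k < k"
  have "cdfalls n \<sigma> = {k. ?P \<sigma> k}" if "\<sigma> \<in> low_perms n" for \<sigma>
    using that perms_moved[of \<sigma> n] by (fastforce simp: cdfalls_def low_perms_def)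
  then have "(\<Sum>\<sigma>\<in>low_perms n. (- 1 :: int) ^ card (cdfalls n \<sigma>)) =
      (\<Sum>\<sigma>\<in>low_perms n. (- 1) ^ card {k. ?P \<sigma> k})"
    by (intro sum.cong) simp_all
  also have "\<dots> = (if n = 0 then 1 else 2 ^ (n - 1))"
  proof (rule sum_low_perms)
    fix n \<sigma> and k :: nat assume "\<sigma> \<in> perms (Suc n)" "k < n"
    then show "?P (\<sigma> \<circ> transpose n (Suc n)) k = ?P \<sigma> k"
      "?P (transpose n (Suc n) \<circ> \<sigma>) k = ?P \<sigma> k"
      by (simp_all add: inv_comp_transpose transpose_Suc_compare)
  next
    fix n \<sigma> and k :: nat assume "\<sigma> \<in> perms n" "n \<le> k"
    then show "\<not> ?P \<sigma> k" using perms_above[OF inv_in_perms, of \<sigma> n k k] by auto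
  next
    fix n \<sigma> assume \<sigma>: "\<sigma> \<in> perms n" "\<sigma> n = n"
    then show "\<not> ?P (\<sigma> \<circ> transpose n (Suc n)) n"
      using perms_top[OF \<sigma>(1)] by (simp add: inv_comp_transpose)
  next
    fix n \<sigma> assume \<sigma>: "\<sigma> \<in> perms n" "\<sigma> n \<noteq> n"
    note top = perms_top[OF \<sigma>(1)]
    have "\<sigma> n < n" "inv \<sigma> n < n" using top \<sigma>(2) by auto
    then show "of_bool (?P (\<sigma> \<circ> transpose n (Suc n)) n) + of_bool (?P (transpose n (Suc n) \<circ> \<sigma>) n) +
      of_bool (?P (transpose n (Suc n) \<circ> \<sigma> \<circ> transpose n (Suc n)) n) = (1 :: nat)"
      using top inv_comp_transpose[OF \<sigma>(1)] by (simp add: transpose_def)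
  qed
  finally show ?thesis .
qed

text \<open>At height at most one, both \<open>nrfix\<close> and \<open>psnest\<close> are the
  cardinality of this set.\<close>

definition nested_fixes :: "(nat \<Rightarrow> nat) \<Rightarrow> nat set" where
  "nested_fixes \<sigma> = {k. \<sigma> k = k \<and> (\<exists>l<k. k < \<sigma> l)}"

lemma sum_low_perms_nested_fixes:
  "(\<Sum>\<sigma>\<in>low_perms n. (- 1 :: int) ^ card (nested_fixes \<sigma>)) = (if n = 0 then 1 else 2 ^ (n - 1))"
  unfolding nested_fixes_def
proof (rule sum_low_perms)
  let ?P = "\<lambda>\<sigma> k :: nat. \<sigma> k = k \<and> (\<exists>l<k. k < \<sigma> l)"
  {
    fix n \<sigma> and k :: nat assume "\<sigma> \<in> perms (Suc n)" "k < n"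
    moreover have "transpose n (Suc n) l = l" if "l < k" for l
      using that \<open>k < n\<close> by simp
    ultimately show "?P (\<sigma> \<circ> transpose n (Suc n)) k = ?P \<sigma> k"
      "?P (transpose n (Suc n) \<circ> \<sigma>) k = ?P \<sigma> k"
      by (auto simp: transpose_Suc_compare)
  next
    fix n \<sigma> and k :: nat assume "\<sigma> \<in> perms n" "n \<le> k"
    then show "\<not> ?P \<sigma> k" using perms_above[of \<sigma> n _ k] by fastforce
  next
    fix n \<sigma> assume \<sigma>: "\<sigma> \<in> perms n" "\<sigma> n = n"
    then show "\<not> ?P (\<sigma> \<circ> transpose n (Suc n)) n"
      using perms_top[OF \<sigma>(1)] by simp
  next
    fix n \<sigma> assume \<sigma>: "\<sigma> \<in> perms n" "\<sigma> n \<noteq> n"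
    note top = perms_top[OF \<sigma>(1)]
    have "\<sigma> n < n" "inv \<sigma> n < n" using top \<sigma>(2) by auto
    moreover have "\<sigma> (inv \<sigma> n) = n" by (rule perms_inverses[OF \<sigma>(1)])
    \<comment> \<open>The preimage of \<open>n\<close> under \<sigma> is now sent to
      \<open>Suc n\<close>, so its arc passes over the new fixed point \<open>n\<close>.\<close>
    ultimately have "\<exists>l<n. n < (transpose n (Suc n) \<circ> \<sigma> \<circ> transpose n (Suc n)) l"
      by (intro exI[of _ "inv \<sigma> n"]) simp
    then show "of_bool (?P (\<sigma> \<circ> transpose n (Suc n)) n) + of_bool (?P (transpose n (Suc n) \<circ> \<sigma>) n) +
      of_bool (?P (transpose n (Suc n) \<circ> \<sigma> \<circ> transpose n (Suc n)) n) = (1 :: nat)"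
      using top \<open>\<sigma> n < n\<close> by simp
  }
qed

section \<open>Values of the statistics at height at most one\<close>

text \<open>An earlier larger value would put a second rising arc over the gap after
  \<open>k\<close>; a later smaller value would put a second falling arc over the gap before
  \<open>k\<close>.\<close>

lemma low_perms_recs_arecs:
  assumes "\<sigma> \<in> low_perms n" "k \<in> {1..n}"
  shows "k < \<sigma> k \<Longrightarrow> k \<in> recs n \<sigma>" "\<sigma> k < k \<Longrightarrow> k \<in> arecs n \<sigma>"
proof -
  assume k: "k < \<sigma> k"
  have "\<sigma> l < \<sigma> k" if "l < k" for l
    using low_perms_inj[OF assms(1), of l k k] that k by force
  then show "k \<in> recs n \<sigma>" using assms(2) by (simp add: recs_def)
next
  assume k: "\<sigma> k < k"
  have "\<sigma> k < \<sigma> l" if "k < l" for l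
    using low_perms_inj'[OF assms(1), of "k - 1" l k] that k by force
  then show "k \<in> arecs n \<sigma>" using assms(2) by (simp add: arecs_def)
qed

lemma low_perms_Int:
  assumes "\<sigma> \<in> low_perms n"
  shows "cpeaks n \<sigma> \<inter> earecs n \<sigma> = cpeaks n \<sigma>" "cdfalls n \<sigma> \<inter> earecs n \<sigma> = cdfalls n \<sigma>"
    "cvals n \<sigma> \<inter> erecs n \<sigma> = cvals n \<sigma>" "cdrises n \<sigma> \<inter> erecs n \<sigma> = cdrises n \<sigma>"
    "cpeaks n \<sigma> \<inter> nrars n \<sigma> = {}" "cdfalls n \<sigma> \<inter> nrars n \<sigma> = {}"
    "cvals n \<sigma> \<inter> nrars n \<sigma> = {}" "cdrises n \<sigma> \<inter> nrars n \<sigma> = {}"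
proof -
  have \<sigma>: "\<sigma> permutes {1..n}" using assms by (simp add: low_perms_def perms_def)
  have "k \<in> erecs n \<sigma>" "k \<notin> nrars n \<sigma>" if "k \<in> {1..n}" "k < \<sigma> k" for k
    using low_perms_recs_arecs(1)[OF assms that] arecs_imp_ge[OF \<sigma>, of k] that
    by (auto simp: erecs_def nrars_def)
  moreover have "k \<in> earecs n \<sigma>" "k \<notin> nrars n \<sigma>" if "k \<in> {1..n}" "\<sigma> k < k" for k
    using low_perms_recs_arecs(2)[OF assms that] recs_imp_le[OF \<sigma>, of k] that
    by (auto simp: earecs_def nrars_def)
  ultimately show "cpeaks n \<sigma> \<inter> earecs n \<sigma> = cpeaks n \<sigma>" "cdfalls n \<sigma> \<inter> earecs n \<sigma> = cdfalls n \<sigma>"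
    "cvals n \<sigma> \<inter> erecs n \<sigma> = cvals n \<sigma>" "cdrises n \<sigma> \<inter> erecs n \<sigma> = cdrises n \<sigma>"
    "cpeaks n \<sigma> \<inter> nrars n \<sigma> = {}" "cdfalls n \<sigma> \<inter> nrars n \<sigma> = {}"
    "cvals n \<sigma> \<inter> nrars n \<sigma> = {}" "cdrises n \<sigma> \<inter> nrars n \<sigma> = {}"
    unfolding cpeaks_def cdfalls_def cvals_def cdrises_def by blast+
qed

text \<open>By \<open>permutes_card_crossing\<close> a rising arc over a fixed point is matched by a
  falling one. The former prevents a record, the latter an antirecord.\<close>

lemma low_perms_fix_nrars:
  assumes "\<sigma> \<in> low_perms n"
  shows "fixes_of n \<sigma> \<inter> nrars n \<sigma> = nested_fixes \<sigma>"
proof -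
  have \<sigma>: "\<sigma> permutes {1..n}" using assms by (simp add: low_perms_def perms_def)
  have range: "l \<in> {1..n}" if "\<sigma> l \<noteq> l" for l
    using permutes_not_in[OF \<sigma>] that by metis
  show ?thesis
  proof (intro set_eqI iffI)
    fix k assume "k \<in> fixes_of n \<sigma> \<inter> nrars n \<sigma>"
    then have k: "k \<in> {1..n}" "\<sigma> k = k" "k \<notin> recs n \<sigma>"
      by (auto simp: fixes_of_def nrars_def)
    then obtain l where l: "l < k" "\<not> \<sigma> l < k" by (auto simp: recs_def)
    moreover have "\<sigma> l \<noteq> k" using l k permutes_inj[OF \<sigma>] by (metis injD less_irrefl)
    ultimately show "k \<in> nested_fixes \<sigma>" using k by (auto simp: nested_fixes_def)
  next
    fix k assume "k \<in> nested_fixes \<sigma>"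
    then obtain l where l: "\<sigma> k = k" "l < k" "k < \<sigma> l" by (auto simp: nested_fixes_def)
    then have "l \<in> {1..n}" using range[of l] by auto
    then have "\<sigma> l \<in> {1..n}" using permutes_in_image[OF \<sigma>] by blast
    then have k: "k \<in> {1..n}" using l \<open>l \<in> {1..n}\<close> by auto
    have "k \<notin> recs n \<sigma>" using l \<open>l \<in> {1..n}\<close> by (auto simp: recs_def)
    moreover have "k \<notin> arecs n \<sigma>"
    proof -
      have "{l. l \<le> k \<and> k < \<sigma> l} \<noteq> {}" using l less_imp_le by blast
      then have "card {l. l \<le> k \<and> k < \<sigma> l} \<noteq> 0" by (simp only: card_eq_0_iff) simp
      then have "{l. k < l \<and> \<sigma> l \<le> k} \<noteq> {}"
        using permutes_card_crossing[OF \<sigma>, of k] by (metis card.empty)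
      then obtain m where "k < m" "\<sigma> m \<le> k" by auto
      then show ?thesis using range[of m] l by (auto simp: arecs_def)
    qed
    ultimately show "k \<in> fixes_of n \<sigma> \<inter> nrars n \<sigma>"
      using k l by (auto simp: fixes_of_def nrars_def)
  qed
qed

text \<open>At most one arc passes over a given fixed point, so each summand is 0 or 1.\<close>

lemma low_perms_psnest:
  assumes "\<sigma> \<in> low_perms n"
  shows "psnest n \<sigma> = card (nested_fixes \<sigma>)"
proof -
  have sub: "nested_fixes \<sigma> \<subseteq> fixes_of n \<sigma>"
    using low_perms_fix_nrars[OF assms] by auto
  have \<sigma>: "\<sigma> permutes {1..n}" using assms by (simp add: low_perms_def perms_def)
  have "card {j \<in> {1..n}. j < k \<and> \<sigma> j > k} = (if k \<in> nested_fixes \<sigma> then 1 else 0)"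
    if "k \<in> fixes_of n \<sigma>" for k
  proof (cases "k \<in> nested_fixes \<sigma>")
    case True
    then obtain l where l: "l < k" "k < \<sigma> l" by (auto simp: nested_fixes_def)
    then have "l \<in> {1..n}" using permutes_not_in[OF \<sigma>, of l] by force
    then have "{j \<in> {1..n}. j < k \<and> \<sigma> j > k} = {l}"
      using l low_perms_inj[OF assms, of _ k l] by auto
    then show ?thesis using True by simp
  next
    case False
    then have "{j \<in> {1..n}. j < k \<and> \<sigma> j > k} = {}"
      using that by (auto simp: nested_fixes_def fixes_of_def)
    then show ?thesis using False by (simp only: card.empty if_False)
  qed
  then have "psnest n \<sigma> = (\<Sum>k\<in>fixes_of n \<sigma>. if k \<in> nested_fixes \<sigma> then 1 else 0)"
    unfolding psnest_def by (intro sum.cong) simp_all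
  also have "\<dots> = card (fixes_of n \<sigma> \<inter> nested_fixes \<sigma>)"
    by (simp add: sum.If_cases fixes_of_def Int_def)
  finally show ?thesis using sub by (simp add: Int_absorb1)
qed

text \<open>A crossing or nesting pair consists of two arcs of the same direction over a common
  gap.\<close>

lemma low_perms_crossings:
  assumes "\<sigma> \<in> low_perms n"
  shows "ucross_at n k \<sigma> = 0" "unest_at n k \<sigma> = 0" "lcross_at n k \<sigma> = 0" "lnest_at n k \<sigma> = 0"
proof -
  have 1: "\<not> (l < k \<and> k < \<sigma> l \<and> k < \<sigma> k)" for l
    using low_perms_inj[OF assms, of l k k] by auto
  have 2: "\<not> (k < l \<and> \<sigma> l < k \<and> \<sigma> k < k)" for l
    using low_perms_inj'[OF assms, of "k - 1" l k] by linarith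
  have "{j \<in> {1..n}. j < k \<and> k < \<sigma> j \<and> \<sigma> j < \<sigma> k} = {}" using 1 less_trans by blast
  then show "ucross_at n k \<sigma> = 0" by (simp only: ucross_at_def card.empty)
  have "{j \<in> {1..n}. j < k \<and> k < \<sigma> k \<and> \<sigma> k < \<sigma> j} = {}" using 1 less_trans by blast
  then show "unest_at n k \<sigma> = 0" by (simp only: unest_at_def card.empty)
  have "{j \<in> {1..n}. j > k \<and> k > \<sigma> j \<and> \<sigma> j > \<sigma> k} = {}" using 2 less_trans by blast
  then show "lcross_at n k \<sigma> = 0" by (simp only: lcross_at_def card.empty)
  have "{j \<in> {1..n}. j > k \<and> k > \<sigma> k \<and> \<sigma> k > \<sigma> j} = {}" using 2 less_trans by blast
  then show "lnest_at n k \<sigma> = 0" by (simp only: lnest_at_def card.empty)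
qed

text \<open>The valley's own arc is the only rising arc over the gap to its right, so \<sigma> maps
  the points below the valley among themselves and their cycles never reach it.\<close>

lemma low_perms_cval_min:
  assumes "\<sigma> \<in> low_perms n" "i \<in> cvals n \<sigma>" "j \<in> orbit \<sigma> i"
  shows "i \<le> j"
proof (rule ccontr)
  assume "\<not> i \<le> j"
  have \<sigma>: "\<sigma> permutes {1..n}" using assms by (simp add: low_perms_def perms_def)
  then have perm: "permutation \<sigma>" by (metis finite_atLeastAtMost permutes_imp_permutation)
  have closed: "\<sigma> l < i" if "l < i" for l
  proof -
    have "\<not> i < \<sigma> l"
      using low_perms_inj[OF assms(1), of l i i] that assms(2) by (auto simp: cvals_def)
    moreover have "\<sigma> l \<noteq> i"
      using that assms(2) permutes_inverses(2)[OF \<sigma>, of l] by (auto simp: cvals_def)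
    ultimately show ?thesis by simp
  qed
  have "k < i" if "k \<in> orbit \<sigma> j" for k
    using that by induction (use \<open>\<not> i \<le> j\<close> closed in auto)
  moreover have "i \<in> orbit \<sigma> j"
    using orbit_swap[OF permutation_self_in_orbit[OF perm] assms(3)] .
  ultimately show False by auto
qed

lemma low_perms_minval:
  assumes "\<sigma> \<in> low_perms n"
  shows "minval n \<sigma> = card (cvals n \<sigma>)" "nminval n \<sigma> = 0"
proof -
  have "{i \<in> cvals n \<sigma>. \<forall>j\<in>orbit \<sigma> i. i \<le> j} = cvals n \<sigma>"
    "{i \<in> cvals n \<sigma>. \<not> (\<forall>j\<in>orbit \<sigma> i. i \<le> j)} = {}"
    using low_perms_cval_min[OF assms] by auto
  then show "minval n \<sigma> = card (cvals n \<sigma>)" "nminval n \<sigma> = 0"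
    by (simp_all only: minval_def nminval_def card.empty)
qed

subsection \<open>Reflection of permutations\<close>

text \<open>Taken to be the identity outside \<open>{1..n}\<close>, so that it is a permutation in
  the sense of \<open>permutes\<close> and an involution on all numbers.\<close>

definition reflect :: "nat \<Rightarrow> nat \<Rightarrow> nat" where
  "reflect n k = (if k \<in> {1..n} then Suc n - k else k)"

definition mirror :: "nat \<Rightarrow> (nat \<Rightarrow> nat) \<Rightarrow> nat \<Rightarrow> nat" where
  "mirror n \<sigma> = reflect n \<circ> \<sigma> \<circ> reflect n"

lemma reflect_reflect [simp]: "reflect n (reflect n k) = k"
  by (auto simp: reflect_def)

lemma reflect_in_iff [simp]: "reflect n k \<in> {1..n} \<longleftrightarrow> k \<in> {1..n}"
  by (auto simp: reflect_def)

lemma reflect_less_iff: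
  "k \<in> {1..n} \<Longrightarrow> l \<in> {1..n} \<Longrightarrow> reflect n k < reflect n l \<longleftrightarrow> l < k"
  by (auto simp: reflect_def)

lemma reflect_permutes: "reflect n permutes {1..n}"
  by (rule bij_imp_permutes, rule bij_betwI[where g = "reflect n"]) (auto simp: reflect_def)

lemma mirror_in_perms: "\<sigma> \<in> perms n \<Longrightarrow> mirror n \<sigma> \<in> perms n"
  unfolding perms_def mirror_def using reflect_permutes by (auto intro!: permutes_compose)

lemma mirror_mirror [simp]: "mirror n (mirror n \<sigma>) = \<sigma>"
  by (simp add: mirror_def fun_eq_iff)

lemma mirror_apply: "mirror n \<sigma> k = reflect n (\<sigma> (reflect n k))"
  by (simp add: mirror_def)

lemma inv_mirror:
  assumes "\<sigma> \<in> perms n"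
  shows "inv (mirror n \<sigma>) k = reflect n (inv \<sigma> (reflect n k))"
proof (rule inv_f_eq)
  show "inj (mirror n \<sigma>)"
    using mirror_in_perms[OF assms] permutes_inj by (auto simp: perms_def)
  show "mirror n \<sigma> (reflect n (inv \<sigma> (reflect n k))) = k"
    using perms_inverses[OF assms] by (simp add: mirror_apply)
qed

lemma card_reflect:
  assumes "S \<subseteq> {1..n}" "T \<subseteq> {1..n}" "\<And>k. k \<in> {1..n} \<Longrightarrow> k \<in> S \<longleftrightarrow> reflect n k \<in> T"
  shows "card S = card T"
proof (rule bij_betw_same_card, rule bij_betwI[where f = "reflect n" and g = "reflect n"])
  show "reflect n \<in> S \<rightarrow> T" using assms by auto
  show "reflect n \<in> T \<rightarrow> S"
  proof
    fix k assume "k \<in> T"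
    then have "reflect n k \<in> {1..n}" using assms(2) by (subst reflect_in_iff) auto
    then show "reflect n k \<in> S" using \<open>k \<in> T\<close> assms(3)[of "reflect n k"] by simp
  qed
qed simp_all

lemma sum_reflect:
  assumes "S \<subseteq> {1..n}" "T \<subseteq> {1..n}" "\<And>k. k \<in> {1..n} \<Longrightarrow> k \<in> S \<longleftrightarrow> reflect n k \<in> T"
    and "\<And>k. k \<in> S \<Longrightarrow> f k = g (reflect n k)"
  shows "sum f S = sum g T"
proof (rule sum.reindex_bij_witness[of _ "reflect n" "reflect n"])
  fix k assume "k \<in> T"
  then have "reflect n k \<in> {1..n}" using assms(2) by (subst reflect_in_iff) auto
  then show "reflect n k \<in> S" using \<open>k \<in> T\<close> assms(3)[of "reflect n k"] by simp
next
  fix k assume "k \<in> S"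
  then show "reflect n k \<in> T" using assms by auto
qed (use assms in simp_all)

lemma ball_reflect: "(\<forall>l\<in>{1..n}. Q (reflect n l)) \<longleftrightarrow> (\<forall>l\<in>{1..n}. Q l)"
proof
  assume *: "\<forall>l\<in>{1..n}. Q (reflect n l)"
  show "\<forall>l\<in>{1..n}. Q l"
  proof
    fix l assume "l \<in> {1..n}"
    then have "reflect n l \<in> {1..n}" by (simp only: reflect_in_iff)
    with * have "Q (reflect n (reflect n l))" by blast
    then show "Q l" by simp
  qed
next
  assume *: "\<forall>l\<in>{1..n}. Q l"
  show "\<forall>l\<in>{1..n}. Q (reflect n l)"
  proof
    fix l assume "l \<in> {1..n}"
    then have "reflect n l \<in> {1..n}" by (simp only: reflect_in_iff)
    with * show "Q (reflect n l)" by blast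
  qed
qed

lemma cycle_types_subset:
  "cpeaks n \<rho> \<subseteq> {1..n}" "cvals n \<rho> \<subseteq> {1..n}" "cdrises n \<rho> \<subseteq> {1..n}" "cdfalls n \<rho> \<subseteq> {1..n}"
  "fixes_of n \<rho> \<subseteq> {1..n}"
  by (auto simp: cpeaks_def cvals_def cdrises_def cdfalls_def fixes_of_def)

context
  fixes n :: nat and \<sigma> :: "nat \<Rightarrow> nat"
  assumes \<sigma>: "\<sigma> \<in> perms n"
begin

lemma range_iff: "\<sigma> k \<in> {1..n} \<longleftrightarrow> k \<in> {1..n}" "inv \<sigma> k \<in> {1..n} \<longleftrightarrow> k \<in> {1..n}"
  using permutes_in_image[of \<sigma> "{1..n}"] permutes_in_image[of "inv \<sigma>" "{1..n}"]
    \<sigma> inv_in_perms[OF \<sigma>] unfolding perms_def mem_Collect_eq by blast+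

lemma mirror_compare:
  assumes "k \<in> {1..n}"
  shows "k < mirror n \<sigma> k \<longleftrightarrow> \<sigma> (reflect n k) < reflect n k"
    "mirror n \<sigma> k < k \<longleftrightarrow> reflect n k < \<sigma> (reflect n k)"
    "mirror n \<sigma> k = k \<longleftrightarrow> \<sigma> (reflect n k) = reflect n k"
    "k < inv (mirror n \<sigma>) k \<longleftrightarrow> inv \<sigma> (reflect n k) < reflect n k"
    "inv (mirror n \<sigma>) k < k \<longleftrightarrow> reflect n k < inv \<sigma> (reflect n k)"
proof -
  let ?m = "reflect n k"
  have m: "?m \<in> {1..n}" "\<sigma> ?m \<in> {1..n}" "inv \<sigma> ?m \<in> {1..n}"
    using assms by (simp_all only: range_iff reflect_in_iff)
  show "k < mirror n \<sigma> k \<longleftrightarrow> \<sigma> ?m < ?m" "mirror n \<sigma> k < k \<longleftrightarrow> ?m < \<sigma> ?m"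
    "k < inv (mirror n \<sigma>) k \<longleftrightarrow> inv \<sigma> ?m < ?m" "inv (mirror n \<sigma>) k < k \<longleftrightarrow> ?m < inv \<sigma> ?m"
    using reflect_less_iff[OF m(1,2)] reflect_less_iff[OF m(2,1)]
      reflect_less_iff[OF m(1,3)] reflect_less_iff[OF m(3,1)] inv_mirror[OF \<sigma>, of k]
    by (simp_all add: mirror_apply)
  show "mirror n \<sigma> k = k \<longleftrightarrow> \<sigma> ?m = ?m"
    by (metis mirror_apply reflect_reflect)
qed

lemma mirror_cycle_types:
  assumes "k \<in> {1..n}"
  shows "k \<in> cpeaks n (mirror n \<sigma>) \<longleftrightarrow> reflect n k \<in> cvals n \<sigma>"
    "k \<in> cdrises n (mirror n \<sigma>) \<longleftrightarrow> reflect n k \<in> cdfalls n \<sigma>"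
    "k \<in> cdfalls n (mirror n \<sigma>) \<longleftrightarrow> reflect n k \<in> cdrises n \<sigma>"
    "k \<in> fixes_of n (mirror n \<sigma>) \<longleftrightarrow> reflect n k \<in> fixes_of n \<sigma>"
proof -
  have "reflect n k \<in> {1..n}" using assms by (simp only: reflect_in_iff)
  then show "k \<in> cpeaks n (mirror n \<sigma>) \<longleftrightarrow> reflect n k \<in> cvals n \<sigma>"
    "k \<in> cdrises n (mirror n \<sigma>) \<longleftrightarrow> reflect n k \<in> cdfalls n \<sigma>"
    "k \<in> cdfalls n (mirror n \<sigma>) \<longleftrightarrow> reflect n k \<in> cdrises n \<sigma>"
    "k \<in> fixes_of n (mirror n \<sigma>) \<longleftrightarrow> reflect n k \<in> fixes_of n \<sigma>"
    unfolding cpeaks_def cvals_def cdrises_def cdfalls_def fixes_of_def mem_Collect_eq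
      mirror_compare[OF assms] using assms by blast+
qed

lemma mirror_pair_less:
  assumes "k \<in> {1..n}" "l \<in> {1..n}"
  shows "k < l \<longleftrightarrow> reflect n l < reflect n k"
    "mirror n \<sigma> k < mirror n \<sigma> l \<longleftrightarrow> \<sigma> (reflect n l) < \<sigma> (reflect n k)"
    "k < mirror n \<sigma> l \<longleftrightarrow> \<sigma> (reflect n l) < reflect n k"
    "mirror n \<sigma> k < l \<longleftrightarrow> reflect n l < \<sigma> (reflect n k)"
proof -
  let ?k = "reflect n k" and ?l = "reflect n l"
  have m: "?k \<in> {1..n}" "\<sigma> ?k \<in> {1..n}" "?l \<in> {1..n}" "\<sigma> ?l \<in> {1..n}"
    using assms by (simp_all only: range_iff reflect_in_iff)
  show "k < l \<longleftrightarrow> ?l < ?k" using reflect_less_iff[OF assms(2,1)] by simp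
  show "mirror n \<sigma> k < mirror n \<sigma> l \<longleftrightarrow> \<sigma> ?l < \<sigma> ?k"
    using reflect_less_iff[OF m(2,4)] by (simp add: mirror_apply)
  show "k < mirror n \<sigma> l \<longleftrightarrow> \<sigma> ?l < ?k"
    using reflect_less_iff[OF m(1,4)] by (simp add: mirror_apply)
  show "mirror n \<sigma> k < l \<longleftrightarrow> ?l < \<sigma> ?k"
    using reflect_less_iff[OF m(2,3)] by (simp add: mirror_apply)
qed

lemma mirror_records:
  assumes "k \<in> {1..n}"
  shows "k \<in> recs n (mirror n \<sigma>) \<longleftrightarrow> reflect n k \<in> arecs n \<sigma>"
    "k \<in> arecs n (mirror n \<sigma>) \<longleftrightarrow> reflect n k \<in> recs n \<sigma>"
proof -
  have r: "reflect n k \<in> {1..n}" using assms by (simp only: reflect_in_iff)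
  have "k \<in> recs n (mirror n \<sigma>) \<longleftrightarrow>
      (\<forall>l\<in>{1..n}. reflect n k < reflect n l \<longrightarrow> \<sigma> (reflect n k) < \<sigma> (reflect n l))"
    using assms mirror_pair_less[OF _ assms] by (simp add: recs_def)
  also have "\<dots> \<longleftrightarrow> (\<forall>l\<in>{1..n}. reflect n k < l \<longrightarrow> \<sigma> (reflect n k) < \<sigma> l)"
    by (rule ball_reflect)
  finally show "k \<in> recs n (mirror n \<sigma>) \<longleftrightarrow> reflect n k \<in> arecs n \<sigma>"
    using r by (simp add: arecs_def)
  have "k \<in> arecs n (mirror n \<sigma>) \<longleftrightarrow>
      (\<forall>l\<in>{1..n}. reflect n l < reflect n k \<longrightarrow> \<sigma> (reflect n l) < \<sigma> (reflect n k))"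
    using assms mirror_pair_less[OF assms] by (simp add: arecs_def)
  also have "\<dots> \<longleftrightarrow> (\<forall>l\<in>{1..n}. l < reflect n k \<longrightarrow> \<sigma> l < \<sigma> (reflect n k))"
    by (rule ball_reflect)
  finally show "k \<in> arecs n (mirror n \<sigma>) \<longleftrightarrow> reflect n k \<in> recs n \<sigma>"
    using r by (simp add: recs_def)
qed

lemma mirror_record_types:
  assumes "k \<in> {1..n}"
  shows "k \<in> erecs n (mirror n \<sigma>) \<longleftrightarrow> reflect n k \<in> earecs n \<sigma>"
    "k \<in> earecs n (mirror n \<sigma>) \<longleftrightarrow> reflect n k \<in> erecs n \<sigma>"
    "k \<in> nrars n (mirror n \<sigma>) \<longleftrightarrow> reflect n k \<in> nrars n \<sigma>"
  unfolding erecs_def earecs_def nrars_def Diff_iff Un_iff mirror_records[OF assms] reflect_in_iff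
  by auto

lemma mirror_record_stats:
  "nrcpeak n (mirror n \<sigma>) = nrcval n \<sigma>" "nrfix n (mirror n \<sigma>) = nrfix n \<sigma>"
  "eareccdfall n (mirror n \<sigma>) = ereccdrise n \<sigma>" "ereccdrise n (mirror n \<sigma>) = eareccdfall n \<sigma>"
  "cdrise n (mirror n \<sigma>) = cdfall n \<sigma>" "cdfall n (mirror n \<sigma>) = cdrise n \<sigma>"
  unfolding nrcpeak_def nrcval_def nrfix_def eareccdfall_def ereccdrise_def cdrise_def cdfall_def
  by (rule card_reflect[where n = n];
      (intro cycle_types_subset le_infI1 |
        simp only: Int_iff mirror_cycle_types mirror_record_types))+

text \<open>Reversing the order turns falling arcs into rising ones and puts the partner of
  \<open>k\<close> on its other side.\<close>

lemma mirror_lower_at: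
  assumes "k \<in> {1..n}"
  shows "lcross_at n k (mirror n \<sigma>) = ucross_at n (reflect n k) \<sigma>"
    "lnest_at n k (mirror n \<sigma>) = unest_at n (reflect n k) \<sigma>"
  unfolding lcross_at_def ucross_at_def lnest_at_def unest_at_def
  by (rule card_reflect[where n = n]; (blast |
        simp only: mem_Collect_eq reflect_in_iff mirror_pair_less[OF assms]
          mirror_pair_less[OF _ assms] mirror_compare[OF assms]))+

lemma mirror_lower_stats:
  "lcross n (mirror n \<sigma>) = ucross n \<sigma>" "lnest n (mirror n \<sigma>) = unest n \<sigma>"
  "lcrosscpeak n (mirror n \<sigma>) = ucrosscval n \<sigma>" "lnestcpeak n (mirror n \<sigma>) = unestcval n \<sigma>"
  unfolding lcross_def ucross_def lnest_def unest_def lcrosscpeak_def ucrosscval_def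
    lnestcpeak_def unestcval_def
  by (rule sum_reflect[where n = n];
      (rule order_refl cycle_types_subset | simp only: reflect_in_iff mirror_cycle_types |
        (rule mirror_lower_at; (assumption | erule subsetD[OF cycle_types_subset(1)]))))+

text \<open>Mirroring turns the rising arcs over a fixed point into falling ones, and
  \<open>permutes_card_crossing\<close> shows that there are equally many of each.\<close>

lemma mirror_psnest: "psnest n (mirror n \<sigma>) = psnest n \<sigma>"
  unfolding psnest_def
proof (rule sum_reflect[where n = n])
  fix k assume "k \<in> fixes_of n (mirror n \<sigma>)"
  then have k: "k \<in> {1..n}" and "reflect n k \<in> fixes_of n \<sigma>"
    using mirror_cycle_types cycle_types_subset by blast+
  let ?m = "reflect n k"
  have m: "\<sigma> ?m = ?m" using \<open>?m \<in> fixes_of n \<sigma>\<close> by (simp add: fixes_of_def)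
  have "card {j \<in> {1..n}. j < k \<and> k < mirror n \<sigma> j} = card {l \<in> {1..n}. ?m < l \<and> \<sigma> l < ?m}"
    by (rule card_reflect[where n = n]; (blast |
          simp only: mem_Collect_eq reflect_in_iff mirror_pair_less[OF k] mirror_pair_less[OF _ k]))
  \<comment> \<open>The inequality may be weakened because the fixed point \<open>?m\<close> is its
    own only preimage.\<close>
  also have "{l \<in> {1..n}. ?m < l \<and> \<sigma> l < ?m} = {l. ?m < l \<and> \<sigma> l \<le> ?m}"
  proof -
    have "l \<in> {1..n} \<and> \<sigma> l \<noteq> ?m" if "?m < l" "\<sigma> l \<le> ?m" for l
    proof
      show "l \<in> {1..n}" using perms_moved[OF \<sigma>, of l] that by simp
      show "\<sigma> l \<noteq> ?m" using that m perms_inverses(2)[OF \<sigma>] by (metis less_irrefl)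
    qed
    then show ?thesis by (auto simp: le_less simp del: atLeastAtMost_iff)
  qed
  also have "card \<dots> = card {l. l \<le> ?m \<and> ?m < \<sigma> l}"
    using permutes_card_crossing \<sigma> by (simp add: perms_def)
  also have "{l. l \<le> ?m \<and> ?m < \<sigma> l} = {l \<in> {1..n}. l < ?m \<and> ?m < \<sigma> l}"
  proof -
    have "l \<in> {1..n} \<and> l \<noteq> ?m" if "l \<le> ?m" "?m < \<sigma> l" for l
      using perms_moved[OF \<sigma>, of l] that m by auto
    then show ?thesis by (auto simp: le_less simp del: atLeastAtMost_iff)
  qed
  finally show "card {j \<in> {1..n}. j < k \<and> k < mirror n \<sigma> j} =
      card {j \<in> {1..n}. j < ?m \<and> ?m < \<sigma> j}" .
qed (intro cycle_types_subset | simp only: mirror_cycle_types)+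

end

subsection \<open>The signed count\<close>

definition gamma_stats :: "perm_stat set" where
  "gamma_stats = {eareccdfall, ereccdrise, cdrise, cdfall, nrfix, psnest}"

text \<open>These are the statistics whose parity the exchange flips. In each sum exactly one
  summand flips and the others are unchanged.\<close>

definition upper_beta_stats :: "perm_stat set" where
  "upper_beta_stats = {nrcval, nminval,
     \<lambda>n \<sigma>. eareccpeak n \<sigma> + ereccval n \<sigma>,
     \<lambda>n \<sigma>. eareccpeak n \<sigma> + minval n \<sigma>,
     \<lambda>n \<sigma>. nrcpeak n \<sigma> + nrcval n \<sigma> + nrcdrise n \<sigma> + nrcdfall n \<sigma>,
     ucrosscval, ucross, unestcval, unest,
     \<lambda>n \<sigma>. ucross n \<sigma> + lcross n \<sigma>,
     \<lambda>n \<sigma>. lnest n \<sigma> + unest n \<sigma>}"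

lemma gamma_stats_swapped:
  assumes "\<gamma> \<in> gamma_stats" "valley_swap n \<sigma> i j"
  shows "\<gamma> n (valley_swap.swapped \<sigma> i j) = \<gamma> n \<sigma>"
proof -
  interpret valley_swap n \<sigma> i j by fact
  show ?thesis
    using assms(1) by (auto simp: gamma_stats_def swapped_record_stats psnest_swapped)
qed

lemma upper_beta_stats_swapped:
  assumes "\<beta> \<in> upper_beta_stats" "valley_swap n \<sigma> i j"
  shows "even (\<beta> n (valley_swap.swapped \<sigma> i j)) \<longleftrightarrow> odd (\<beta> n \<sigma>)"
proof -
  interpret valley_swap n \<sigma> i j by fact
  show ?thesis
    using assms(1) unfolding upper_beta_stats_def
    by (elim insertE emptyE)
      (auto simp: nrcval_flips nminval_flips ereccval_flips minval_flips ucrosscval_flips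
        ucross_flips unestcval_flips unest_flips swapped_record_stats lcross_swapped lnest_swapped)
qed

text \<open>The two sums involving \<open>eareccpeak\<close> become peaks plus valleys, which is
  twice the number of valleys; all the others vanish.\<close>

lemma upper_beta_stats_low_perms:
  assumes "\<beta> \<in> upper_beta_stats" "\<sigma> \<in> low_perms n"
  shows "even (\<beta> n \<sigma>)"
proof -
  have "card (cpeaks n \<sigma>) = card (cvals n \<sigma>)"
    using assms(2) card_cpeaks_eq_card_cvals by (simp add: low_perms_def perms_def)
  then show ?thesis
    using assms(1) low_perms_Int[OF assms(2)] low_perms_minval[OF assms(2)]
      low_perms_crossings[OF assms(2)]
    unfolding upper_beta_stats_def
    by (elim insertE emptyE)
      (simp_all add: nrcval_def nrcpeak_def nrcdrise_def nrcdfall_def eareccpeak_def ereccval_def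
        ucrosscval_def ucross_def unestcval_def unest_def lcross_def lnest_def)
qed

lemma sum_low_perms_gamma_stats:
  assumes "\<gamma> \<in> gamma_stats"
  shows "(\<Sum>\<sigma>\<in>low_perms n. (- 1 :: int) ^ \<gamma> n \<sigma>) = (if n = 0 then 1 else 2 ^ (n - 1))"
proof -
  consider "\<And>\<sigma>. \<sigma> \<in> low_perms n \<Longrightarrow> \<gamma> n \<sigma> = card (cdrises n \<sigma>)"
    | "\<And>\<sigma>. \<sigma> \<in> low_perms n \<Longrightarrow> \<gamma> n \<sigma> = card (cdfalls n \<sigma>)"
    | "\<And>\<sigma>. \<sigma> \<in> low_perms n \<Longrightarrow> \<gamma> n \<sigma> = card (nested_fixes \<sigma>)"
    using assms unfolding gamma_stats_def
    by (elim insertE emptyE)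
      (simp_all add: eareccdfall_def ereccdrise_def cdrise_def cdfall_def nrfix_def
        low_perms_Int low_perms_fix_nrars low_perms_psnest)
  then show ?thesis
  proof cases
    case 1
    then show ?thesis using sum_low_perms_cdrise[of n] by simp
  next
    case 2
    then show ?thesis using sum_low_perms_cdfall[of n] by simp
  next
    case 3
    then show ?thesis using sum_low_perms_nested_fixes[of n] by simp
  qed
qed

lemma signed_sum_upper:
  assumes "\<beta> \<in> upper_beta_stats" "\<gamma> \<in> gamma_stats"
  shows "(\<Sum>\<sigma>\<in>perms n. (- 1 :: int) ^ (\<beta> n \<sigma> + \<gamma> n \<sigma>)) = (if n = 0 then 1 else 2 ^ (n - 1))"
proof -
  have "(\<Sum>\<sigma>\<in>perms n. (- 1 :: int) ^ (\<beta> n \<sigma> + \<gamma> n \<sigma>)) =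
      (\<Sum>\<sigma>\<in>low_perms n. (- 1) ^ (\<beta> n \<sigma> + \<gamma> n \<sigma>))"
    by (rule sum_perms_eq_sum_low_perms)
      (auto simp: gamma_stats_swapped[OF assms(2)] upper_beta_stats_swapped[OF assms(1)])
  also have "\<dots> = (\<Sum>\<sigma>\<in>low_perms n. (- 1) ^ \<gamma> n \<sigma>)"
    by (intro sum.cong) (simp_all add: power_add upper_beta_stats_low_perms[OF assms(1)])
  finally show ?thesis by (simp add: sum_low_perms_gamma_stats[OF assms(2)])
qed

text \<open>Mirroring carries each of these statistics to one in \<open>upper_beta_stats\<close> and
  maps \<open>gamma_stats\<close> into itself, so \<open>signed_sum_upper\<close> applies.\<close>

lemma signed_sum_lower:
  assumes "\<beta> \<in> {nrcpeak, lcrosscpeak, lcross, lnestcpeak, lnest}" "\<gamma> \<in> gamma_stats"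
  shows "(\<Sum>\<sigma>\<in>perms n. (- 1 :: int) ^ (\<beta> n \<sigma> + \<gamma> n \<sigma>)) = (if n = 0 then 1 else 2 ^ (n - 1))"
proof -
  obtain \<beta>' where \<beta>': "\<beta>' \<in> upper_beta_stats" "\<And>\<sigma>. \<sigma> \<in> perms n \<Longrightarrow> \<beta> n (mirror n \<sigma>) = \<beta>' n \<sigma>"
  proof -
    have "\<exists>\<beta>'\<in>{nrcval, ucrosscval, ucross, unestcval, unest}.
        \<forall>\<sigma>\<in>perms n. \<beta> n (mirror n \<sigma>) = \<beta>' n \<sigma>"
      using assms(1) mirror_record_stats(1) mirror_lower_stats by auto
    then show ?thesis using that unfolding upper_beta_stats_def by blast
  qed
  obtain \<gamma>' where \<gamma>': "\<gamma>' \<in> gamma_stats" "\<And>\<sigma>. \<sigma> \<in> perms n \<Longrightarrow> \<gamma> n (mirror n \<sigma>) = \<gamma>' n \<sigma>"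
  proof -
    have "\<exists>\<gamma>'\<in>gamma_stats. \<forall>\<sigma>\<in>perms n. \<gamma> n (mirror n \<sigma>) = \<gamma>' n \<sigma>"
      using assms(2) mirror_record_stats mirror_psnest unfolding gamma_stats_def by auto
    then show ?thesis using that by blast
  qed
  have "(\<Sum>\<sigma>\<in>perms n. (- 1 :: int) ^ (\<beta> n \<sigma> + \<gamma> n \<sigma>)) =
      (\<Sum>\<sigma>\<in>perms n. (- 1) ^ (\<beta>' n \<sigma> + \<gamma>' n \<sigma>))"
  proof (rule sum.reindex_bij_witness[of _ "mirror n" "mirror n"])
    fix \<sigma> assume "\<sigma> \<in> perms n"
    then show "(- 1 :: int) ^ (\<beta>' n (mirror n \<sigma>) + \<gamma>' n (mirror n \<sigma>)) = (- 1) ^ (\<beta> n \<sigma> + \<gamma> n \<sigma>)"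
      using \<beta>'(2)[of "mirror n \<sigma>"] \<gamma>'(2)[of "mirror n \<sigma>"] mirror_in_perms[of \<sigma> n] by simp
  qed (simp_all add: mirror_in_perms)
  then show ?thesis by (simp add: signed_sum_upper[OF \<beta>'(1) \<gamma>'(1)])
qed

theorem theorem3p5:
  fixes Stat Stat_\<gamma> Stat_\<beta> :: perm_stat
  assumes "\<And>n \<sigma>. \<sigma> \<in> perms n \<Longrightarrow> Stat n \<sigma> = Stat_\<beta> n \<sigma> + Stat_\<gamma> n \<sigma>"
    and "Stat_\<gamma> \<in> {eareccdfall, ereccdrise, cdrise, cdfall, nrfix, psnest}"
    and "Stat_\<beta> \<in> {nrcpeak, nrcval, nminval,
           \<lambda>n \<sigma>. eareccpeak n \<sigma> + ereccval n \<sigma>,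
           \<lambda>n \<sigma>. eareccpeak n \<sigma> + minval n \<sigma>,
           \<lambda>n \<sigma>. nrcpeak n \<sigma> + nrcval n \<sigma> + nrcdrise n \<sigma> + nrcdfall n \<sigma>,
           lcrosscpeak, lcross, lnestcpeak, lnest,
           ucrosscval, ucross, unestcval, unest,
           \<lambda>n \<sigma>. ucross n \<sigma> + lcross n \<sigma>,
           \<lambda>n \<sigma>. lnest n \<sigma> + unest n \<sigma>}"
  shows "exhibits_csp Stat (\<lambda>n. if n = 0 then 1 else 2 ^ (n - 1))"
proof -
  have \<gamma>: "Stat_\<gamma> \<in> gamma_stats" using assms(2) by (simp add: gamma_stats_def)
  have "Stat_\<beta> \<in> {nrcpeak, lcrosscpeak, lcross, lnestcpeak, lnest} \<or> Stat_\<beta> \<in> upper_beta_stats"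
    using assms(3) unfolding upper_beta_stats_def by blast
  then have sum: "(\<Sum>\<sigma>\<in>perms n. (- 1 :: int) ^ (Stat_\<beta> n \<sigma> + Stat_\<gamma> n \<sigma>)) =
      (if n = 0 then 1 else 2 ^ (n - 1))" for n
    using signed_sum_lower[OF _ \<gamma>] signed_sum_upper[OF _ \<gamma>] by blast
  have 1: "poly (stat_poly Stat n) 1 = int (card (perms n))" for n
    by (simp add: stat_poly_def poly_sum poly_monom)
  have 2: "poly (stat_poly Stat n) (- 1) = int (if n = 0 then 1 else 2 ^ (n - 1))" for n
    \<comment> \<open>At \<open>- 1\<close> the generating polynomial becomes the signed
      count.\<close>
    using sum[of n] assms(1) by (simp add: stat_poly_def poly_sum poly_monom)
  show ?thesis
    unfolding exhibits_csp_def involution_csp_def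
  proof (intro allI impI conjI)
    fix n \<phi>
    assume *: "involution_on (perms n) \<phi> \<and>
      card {\<sigma> \<in> perms n. \<phi> \<sigma> = \<sigma>} = (if n = 0 then 1 else 2 ^ (n - 1))"
    show "poly (stat_poly Stat n) 1 = int (card (perms n))" by (rule 1)
    show "poly (stat_poly Stat n) (- 1) = int (card {\<sigma> \<in> perms n. \<phi> \<sigma> = \<sigma>})"
      unfolding conjunct2[OF *] by (rule 2)
  qed
qed

end
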